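(* For a full-dimensional polytope $P$ in $\mathbb{P}^n$ with a simple hyperplane arrangement $\mathcal{H}_P$, the base locus of the Wachspress map $\omega_P$ is the residual arrangement $\mathcal{R}_P$.
   Context: $\mathbb{P}^n$ is complex projective $n$-space. A full-dimensional polytope $P$ in $\mathbb{P}^n$ is the collection of the Zariski closures in $\mathbb{P}^n$ of the (nonempty) faces of a full-dimensional convex polytope in an affine chart $\mathbb{R}^n\subset\mathbb{P}^n$. $\mathcal{H}_P$ is the arrangement of hyperplanes spanned by the facets of $P$; it is simple if through any point of $\mathbb{P}^n$ pass at most $n$ hyperplanes of $\mathcal{H}_P$ (so $P$ is then a simple polytope). The residual arrangement $\mathcal{R}_P$ is the union, with its reduced scheme structure, of all linear spaces that are intersections of hyperplanes in $\mathcal{H}_P$ and do not contain any face of $P$. Let $V(P)$ and $\mathcal{F}(P)$ be the sets of vertices and facets of $P$, $N=|V(P)|$, and for $F\in\mathcal{F}(P)$ let $\ell_F$ be a homogeneous linear form defining the hyperplane spanned by $F$. The Wachspress map is the rational map $$\omega_P:\mathbb{P}^n\dashrightarrow\mathbb{P}^{N-1},\qquad t\longmapsto\Bigl(\prod_{F\in\mathcal{F}(P):\,u\notin F}\ell_F(t)\Bigr)_{u\in V(P)}.$$ Its base locus is the common zero locus of these $N$ coordinate forms, regarded as a subscheme of $\mathbb{P}^n$. *)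

theory Defs
  imports "HOL-Analysis.Analysis" "HOL-Library.Poly_Mapping"
begin

subsection \<open>Complex projective space\<close>

text \<open>Points are lines through the origin of \<open>complex ^ 'i\<close>, so the dimension is \<open>CARD('i) - 1\<close>.
  Projective \<open>n\<close>-space with \<open>n = CARD('n)\<close> is \<open>'n option proj\<close>.\<close>

typedef 'i proj = "{vec.span {v} |v :: complex ^ ('i::finite). v \<noteq> 0}"
  morphisms line_of Abs_proj
  by (auto intro: exI[of _ 1])

definition proj_point :: "complex ^ 'i \<Rightarrow> ('i::finite) proj" where
  "proj_point v = Abs_proj (vec.span {v})"

definition proj_span :: "('i::finite) proj set \<Rightarrow> 'i proj set" where
  "proj_span X = {p. line_of p \<subseteq> vec.span (\<Union>q\<in>X. line_of q)}"

definition span_dim :: "('i::finite) proj set \<Rightarrow> int" where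
  "span_dim X = int (vec.dim (\<Union>q\<in>X. line_of q)) - 1"


subsection \<open>Polynomials and the Zariski topology\<close>

type_synonym 'i cpoly = "('i \<Rightarrow>\<^sub>0 nat) \<Rightarrow>\<^sub>0 complex"

definition eval_poly :: "('i::finite) cpoly \<Rightarrow> complex ^ 'i \<Rightarrow> complex" where
  "eval_poly f v =
     (\<Sum>m\<in>Poly_Mapping.keys f. Poly_Mapping.lookup f m * (\<Prod>i\<in>UNIV. v $ i ^ Poly_Mapping.lookup m i))"

definition homogeneous :: "nat \<Rightarrow> ('i::finite) cpoly \<Rightarrow> bool" where
  "homogeneous d f \<longleftrightarrow> (\<forall>m\<in>Poly_Mapping.keys f. (\<Sum>i\<in>UNIV. Poly_Mapping.lookup m i) = d)"

definition zero_locus :: "('i::finite) cpoly set \<Rightarrow> 'i proj set" where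
  "zero_locus G = {p. \<forall>f\<in>G. \<forall>v\<in>line_of p. eval_poly f v = 0}"

definition zariski_closed :: "('i::finite) proj set \<Rightarrow> bool" where
  "zariski_closed Z \<longleftrightarrow> (\<exists>G. (\<forall>f\<in>G. \<exists>d. homogeneous d f) \<and> Z = zero_locus G)"

definition zariski_closure :: "('i::finite) proj set \<Rightarrow> 'i proj set" where
  "zariski_closure X = zariski_closed hull X"


subsection \<open>Closed subschemes of projective space\<close>

text \<open>A closed subscheme is given by its ideal sheaf, and an ideal sheaf by its sections on the
  standard charts \<open>D\<^sub>+(x\<^sub>i)\<close>. The coordinate ring of \<open>D\<^sub>+(x\<^sub>i)\<close> is the ring of polynomials in the
  remaining variables, the variable \<open>x\<^sub>j\<close> standing for \<open>x\<^sub>j / x\<^sub>i\<close>. So a subscheme is encoded as a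
  function sending \<open>i\<close> to an ideal of \<open>chart_ring i\<close>, and two closed subschemes are equal iff
  these functions are.\<close>

type_synonym 'i subscheme = "'i \<Rightarrow> 'i cpoly set"

definition chart_ring :: "'i \<Rightarrow> ('i::finite) cpoly set" where
  "chart_ring i = {f. \<forall>m\<in>Poly_Mapping.keys f. Poly_Mapping.lookup m i = 0}"

definition dehomogenize :: "'i \<Rightarrow> ('i::finite) cpoly \<Rightarrow> 'i cpoly" where
  "dehomogenize i f =
     (\<Sum>m\<in>Poly_Mapping.keys f.
        Poly_Mapping.single (Poly_Mapping.update i 0 m) (Poly_Mapping.lookup f m))"

definition ideal_of :: "'a::comm_ring_1 set \<Rightarrow> 'a set" where
  "ideal_of G = module.span (*) G"

text \<open>For a set \<open>G\<close> of forms, \<open>f\<close> of degree \<open>d\<close> in the ideal of \<open>G\<close> gives the section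
  \<open>f / x\<^sub>i\<^sup>d\<close>, i.e. \<open>f\<close> with \<open>x\<^sub>i\<close> set to 1. Setting \<open>x\<^sub>i\<close> to 1 is a surjective ring homomorphism
  onto \<open>chart_ring i\<close>, so the image is the ideal generated by the dehomogenizations of \<open>G\<close>.\<close>

definition zero_scheme :: "('i::finite) cpoly set \<Rightarrow> 'i subscheme" where
  "zero_scheme G = (\<lambda>i. dehomogenize i ` ideal_of G)"

definition reduced_scheme :: "('i::finite) proj set \<Rightarrow> 'i subscheme" where
  "reduced_scheme Z =
     (\<lambda>i. {f \<in> chart_ring i. \<forall>p\<in>Z. \<forall>v\<in>line_of p. v $ i = 1 \<longrightarrow> eval_poly f v = 0})"


subsection \<open>Polytopes in projective space\<close>

text \<open>An affine chart of \<open>\<real>\<^sup>n\<close>: the map \<open>x \<mapsto> (1 : x)\<close> followed by a projective change of coordinates.\<close>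

definition affine_chart :: "(real ^ 'n \<Rightarrow> ('n::finite) option proj) \<Rightarrow> bool" where
  "affine_chart \<phi> \<longleftrightarrow>
     (\<exists>A :: complex ^ 'n option ^ 'n option. invertible A \<and>
        \<phi> = (\<lambda>x. proj_point
               (A *v (\<chi> i. case i of None \<Rightarrow> 1 | Some j \<Rightarrow> complex_of_real (x $ j)))))"

definition proj_polytope :: "('n::finite) option proj set set \<Rightarrow> bool" where
  "proj_polytope P \<longleftrightarrow>
     (\<exists>(Q :: (real ^ 'n) set) \<phi>. polytope Q \<and> aff_dim Q = int CARD('n) \<and> affine_chart \<phi> \<and>
        P = {zariski_closure (\<phi> ` F) |F. F face_of Q \<and> F \<noteq> {}})"

definition vertices :: "('n::finite) option proj set set \<Rightarrow> 'n option proj set" where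
  "vertices P = {u. {u} \<in> P}"

text \<open>The elements of a projective polytope are linear spaces, so that \<open>span_dim\<close> is
  their dimension.\<close>

definition facets :: "('n::finite) option proj set set \<Rightarrow> 'n option proj set set" where
  "facets P = {F \<in> P. span_dim F = int CARD('n) - 1}"

definition arrangement :: "('n::finite) option proj set set \<Rightarrow> 'n option proj set set" where
  "arrangement P = proj_span ` facets P"

definition simple_arrangement :: "('n::finite) option proj set set \<Rightarrow> bool" where
  "simple_arrangement P \<longleftrightarrow> (\<forall>p. card {H \<in> arrangement P. p \<in> H} \<le> CARD('n))"

definition residual_arrangement :: "('n::finite) option proj set set \<Rightarrow> 'n option proj set" where
  "residual_arrangement P =
     \<Union>{L. (\<exists>\<A> \<subseteq> arrangement P. L = \<Inter>\<A>) \<and> (\<forall>F\<in>P. \<not> F \<subseteq> L)}"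


subsection \<open>The Wachspress map\<close>

definition defines_hyperplane :: "('i::finite) cpoly \<Rightarrow> 'i proj set \<Rightarrow> bool" where
  "defines_hyperplane l H \<longleftrightarrow> homogeneous 1 l \<and> zero_locus {l} = H"

text \<open>The rational map is represented by its tuple of coordinate forms, indexed by the
  vertices. The form \<open>l F\<close> is to define the hyperplane spanned by the facet \<open>F\<close>.\<close>

definition wachspress ::
  "('n::finite) option proj set set \<Rightarrow> ('n option proj set \<Rightarrow> 'n option cpoly)
    \<Rightarrow> 'n option proj \<Rightarrow> 'n option cpoly" where
  "wachspress P l u = (\<Prod>F\<in>{F \<in> facets P. u \<notin> F}. l F)"

definition wachspress_base_locus ::
  "('n::finite) option proj set set \<Rightarrow> ('n option proj set \<Rightarrow> 'n option cpoly)
    \<Rightarrow> 'n option subscheme" where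
  "wachspress_base_locus P l = zero_scheme (wachspress P l ` vertices P)"

end

theory Submission
  imports Defs
begin

text \<open>
  Two facts make the theorem true, one about points and one about ideals.

  On points: a point \<open>p\<close> lies outside the zero locus of the Wachspress coordinates iff some vertex
  \<open>u\<close> lies on every facet hyperplane through \<open>p\<close>. Every face contains a vertex, so this says that the
  smallest intersection of hyperplanes through \<open>p\<close> contains a face, that is, that \<open>p\<close> is not on the
  residual arrangement (lemma \<open>residual_arrangement_eq_zero_locus\<close>).

  On ideals: the base locus is already reduced. This holds for every set of squarefree products of
  linear forms, provided that the forms vanishing at any given point are linearly independent
  (theorem \<open>zero_scheme_products_of_linear_forms_reduced\<close>). The reason is that near a point \<open>v\<close> the
  forms vanishing at \<open>v\<close> are part of a coordinate system and the other ones are units, so that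
  locally the ideal is generated by squarefree monomials in the coordinates, and such an ideal is
  radical: if \<open>f\<close> vanishes on its zero set, which is a union of coordinate subspaces, then every
  monomial of \<open>f\<close> is divisible by one of the generators. Inverting the units amounts to
  multiplying \<open>f\<close> by the product of all forms that do not vanish at \<open>v\<close>
  (lemma \<open>vanishing_locally_in_ideal\<close>). Finally, these products, one for each \<open>v\<close>, have no common
  zero; they are products of linear forms, so elementary linear algebra replaces the Nullstellensatz
  in showing that they generate the unit ideal (lemma \<open>one_in_ideal_of_cofactors\<close>).

  It remains to see that simplicity of the arrangement gives the independence. If at most \<open>n\<close> of the
  hyperplanes pass through each point, then a dependency among the forms vanishing at a point would
  produce a point on \<open>n + 1\<close> of the hyperplanes, provided that there are at least \<open>n + 1\<close> of them
  (lemma \<open>general_position_independent\<close>). A polytope of dimension \<open>n\<close> has that many facets, because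
  fewer facet inequalities would leave it unbounded (lemma \<open>polytope_facet_lower_bound\<close>), and
  distinct facets give distinct hyperplanes since the Zariski closure of a face is the linear space
  that it spans and a real affine equation of the face persists on this space
  (lemmas \<open>zariski_closure_convex_cone\<close> and \<open>lift_in_span_hyperplane\<close>).
\<close>

section \<open>Polynomials as functions\<close>

abbreviation lookup :: "('a \<Rightarrow>\<^sub>0 'b::zero) \<Rightarrow> 'a \<Rightarrow> 'b" where
  "lookup \<equiv> Poly_Mapping.lookup"
abbreviation keys :: "('a \<Rightarrow>\<^sub>0 'b::zero) \<Rightarrow> 'a set" where
  "keys \<equiv> Poly_Mapping.keys"

definition monom_value :: "(('i::finite) \<Rightarrow>\<^sub>0 nat) \<Rightarrow> complex ^ 'i \<Rightarrow> complex" where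
  "monom_value m v = (\<Prod>i\<in>UNIV. v $ i ^ lookup m i)"

lemma eval_poly_monom_value: "eval_poly f v = (\<Sum>m\<in>keys f. lookup f m * monom_value m v)"
  by (simp add: eval_poly_def monom_value_def)

lemma eval_poly_superset:
  assumes "finite K" "keys f \<subseteq> K"
  shows "eval_poly f v = (\<Sum>m\<in>K. lookup f m * monom_value m v)"
  unfolding eval_poly_monom_value using assms
  by (intro sum.mono_neutral_left) (auto simp: in_keys_iff)

lemma eval_poly_add [simp]: "eval_poly (f + g) v = eval_poly f v + eval_poly g v"
proof -
  have "keys (f + g) \<subseteq> keys f \<union> keys g" by (rule keys_add)
  then show ?thesis
    by (simp add: eval_poly_superset[of "keys f \<union> keys g"] lookup_add ring_distribs sum.distrib)
qed

lemma eval_poly_0 [simp]: "eval_poly 0 v = 0"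
  by (simp add: eval_poly_def)

lemma eval_poly_sum [simp]: "eval_poly (sum f A) v = (\<Sum>a\<in>A. eval_poly (f a) v)"
  by (induction A rule: infinite_finite_induct) auto

lemma eval_poly_single [simp]:
  "eval_poly (Poly_Mapping.single m c) v = c * monom_value m v"
  by (cases "c = 0") (auto simp: eval_poly_monom_value)

lemma monom_value_0 [simp]: "monom_value 0 v = 1"
  by (simp add: monom_value_def)

lemma monom_value_add: "monom_value (m + m') v = monom_value m v * monom_value m' v"
  by (simp add: monom_value_def lookup_add power_add prod.distrib)

lemma sum_single_keys: "(\<Sum>m\<in>keys f. Poly_Mapping.single m (lookup f m)) = f"
  by (rule poly_mapping_eqI)
     (auto simp: lookup_sum lookup_single when_def in_keys_iff)

lemma eval_poly_mult [simp]: "eval_poly (f * g) v = eval_poly f v * eval_poly g v"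
proof -
  have "f * g = (\<Sum>m\<in>keys f. \<Sum>m'\<in>keys g.
      Poly_Mapping.single (m + m') (lookup f m * lookup g m'))"
    by (subst (1) sum_single_keys[of f, symmetric], subst (1) sum_single_keys[of g, symmetric])
       (simp add: sum_product mult_single)
  then show ?thesis
    by (simp add: monom_value_add eval_poly_monom_value[of f] eval_poly_monom_value[of g] sum_product mult_ac)
qed

lemma eval_poly_1 [simp]: "eval_poly 1 v = 1"
  using eval_poly_single[of 0 1 v] by simp

lemma eval_poly_power [simp]: "eval_poly (f ^ k) v = eval_poly f v ^ k"
  by (induction k) auto

lemma eval_poly_prod [simp]: "eval_poly (prod f A) v = (\<Prod>a\<in>A. eval_poly (f a) v)"
  by (induction A rule: infinite_finite_induct) auto

lemma eval_poly_uminus [simp]: "eval_poly (- f) v = - eval_poly f v"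
  by (metis add_eq_0_iff eval_poly_0 eval_poly_add)

lemma eval_poly_diff [simp]: "eval_poly (f - g) v = eval_poly f v - eval_poly g v"
  using eval_poly_add[of f "- g" v] by simp

lemma monom_value_mult: "monom_value m (\<chi> i. v $ i * w $ i) = monom_value m v * monom_value m w"
  by (simp add: monom_value_def power_mult_distrib prod.distrib)

text \<open>
  Monomials are pairwise distinct characters of the monoid \<open>complex ^ 'i\<close> under coordinatewise
  multiplication, and distinct characters are linearly independent: this is Dedekind's argument.
  Consequently identities between polynomials can be checked by evaluation.
\<close>

lemma monom_value_independent:
  assumes "finite K" "\<And>v. (\<Sum>m\<in>K. c m * monom_value m v) = 0" "m \<in> K"
  shows "c m = 0"
  using assms
proof (induction K arbitrary: c m rule: finite_induct)
  case empty
  then show ?case by simp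
next
  case (insert m0 K)
  have K: "c m = 0" if "m \<in> K" for m
  proof -
    from that insert.hyps have "m \<noteq> m0" by auto
    then obtain j where j: "lookup m j \<noteq> lookup m0 j"
      using poly_mapping_eqI[of m m0] by auto
    (* A point at which the characters m and m0 differ. *)
    define w :: "complex ^ 'a" where "w = (\<chi> i. if i = j then 2 else 1)"
    have w: "monom_value m' w = 2 ^ lookup m' j" for m'
    proof -
      have "monom_value m' w = (\<Prod>i\<in>UNIV. if i = j then 2 ^ lookup m' j else 1)"
        unfolding monom_value_def w_def by (intro prod.cong) auto
      then show ?thesis by simp
    qed
    have "(\<Sum>m\<in>K. (c m * (monom_value m w - monom_value m0 w)) * monom_value m v) = 0" for v
    proof -
      have "0 = (\<Sum>m\<in>insert m0 K. c m * monom_value m (\<chi> i. v $ i * w $ i))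
              - monom_value m0 w * (\<Sum>m\<in>insert m0 K. c m * monom_value m v)"
        by (simp only: insert.prems(1)) simp
      also have "\<dots> = (\<Sum>m\<in>insert m0 K. (c m * (monom_value m w - monom_value m0 w)) * monom_value m v)"
        by (simp only: monom_value_mult sum_distrib_left flip: sum_subtractf)
           (intro sum.cong refl, simp add: algebra_simps)
      also have "\<dots> = (\<Sum>m\<in>K. (c m * (monom_value m w - monom_value m0 w)) * monom_value m v)"
        using insert.hyps by simp
      finally show ?thesis by simp
    qed
    from insert.IH[OF this that] have "c m = 0 \<or> (2::complex) ^ lookup m j = 2 ^ lookup m0 j"
      by (simp add: w)
    moreover have "(2::complex) ^ a \<noteq> 2 ^ b" if "a \<noteq> b" for a b :: nat
    proof
      assume "(2::complex) ^ a = 2 ^ b"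
      then have "(of_nat (2 ^ a) :: complex) = of_nat (2 ^ b)" by simp
      then have "(2::nat) ^ a = 2 ^ b" using of_nat_eq_iff by blast
      then show False using that by simp
    qed
    ultimately show ?thesis using j by blast
  qed
  have "c m0 = 0"
  proof -
    have "(\<Sum>m\<in>insert m0 K. c m * monom_value m (\<chi> i. 1)) = c m0"
      using insert.hyps K by (simp add: monom_value_def)
    then show ?thesis using insert.prems(1) by simp
  qed
  with K insert.prems show ?case by blast
qed

lemma eval_poly_inject: "eval_poly f = eval_poly g \<longleftrightarrow> f = g"
proof
  assume *: "eval_poly f = eval_poly g"
  show "f = g"
  proof (rule poly_mapping_eqI)
    fix m
    have "lookup (f - g) m = 0" if "m \<in> keys (f - g)"
    proof (rule monom_value_independent[OF _ _ that])
      show "(\<Sum>m\<in>keys (f - g). lookup (f - g) m * monom_value m v) = 0" for v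
        using eval_poly_monom_value[of "f - g" v] * by simp
    qed simp
    then have "lookup (f - g) m = 0" by (auto simp: in_keys_iff)
    then show "lookup f m = lookup g m" by (simp add: lookup_minus)
  qed
qed simp

lemma cpoly_eqI: "(\<And>v. eval_poly f v = eval_poly g v) \<Longrightarrow> f = g"
  using eval_poly_inject[of f g] by (simp add: fun_eq_iff)

definition set_coord_one :: "'i \<Rightarrow> complex ^ 'i \<Rightarrow> complex ^ ('i::finite)" where
  "set_coord_one i v = (\<chi> j. if j = i then 1 else v $ j)"

lemma set_coord_one_nth [simp]: "set_coord_one i v $ i = 1"
  by (simp add: set_coord_one_def)

lemma set_coord_one_id: "v $ i = 1 \<Longrightarrow> set_coord_one i v = v"
  by (auto simp: set_coord_one_def vec_eq_iff)

lemma monom_value_update: "monom_value (Poly_Mapping.update i 0 m) v = monom_value m (set_coord_one i v)"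
  unfolding monom_value_def set_coord_one_def by (intro prod.cong) (auto simp: lookup_update)

lemma eval_dehomogenize [simp]: "eval_poly (dehomogenize i f) v = eval_poly f (set_coord_one i v)"
  by (simp only: dehomogenize_def eval_poly_sum eval_poly_single monom_value_update eval_poly_monom_value[of f])

lemma dehomogenize_mult: "dehomogenize i (f * g) = dehomogenize i f * dehomogenize i g"
  by (rule cpoly_eqI) simp

lemma dehomogenize_add: "dehomogenize i (f + g) = dehomogenize i f + dehomogenize i g"
  by (rule cpoly_eqI) simp

lemma keys_sum_subset: "keys (sum f A) \<subseteq> (\<Union>a\<in>A. keys (f a))"
proof (induction A rule: infinite_finite_induct)
  case (insert a A)
  then show ?case using keys_add[of "f a" "sum f A"] by auto
qed auto

lemma dehomogenize_in_chart_ring: "dehomogenize i f \<in> chart_ring i"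
proof -
  have "lookup m i = 0" if "m \<in> keys (dehomogenize i f)" for m
    using that keys_sum_subset[of "\<lambda>m. Poly_Mapping.single (Poly_Mapping.update i 0 m) (lookup f m)" "keys f"]
    by (auto simp: dehomogenize_def lookup_update split: if_splits)
  then show ?thesis by (simp add: chart_ring_def)
qed

lemma dehomogenize_chart_ring:
  assumes "f \<in> chart_ring i"
  shows "dehomogenize i f = f"
proof -
  have "Poly_Mapping.update i 0 m = m" if "m \<in> keys f" for m
    using assms that by (intro poly_mapping_eqI) (auto simp: chart_ring_def lookup_update)
  then show ?thesis
    unfolding dehomogenize_def using sum_single_keys[of f] by simp
qed

section \<open>Linear forms and coordinates\<close>

definition pairing :: "complex ^ ('i::finite) \<Rightarrow> complex ^ 'i \<Rightarrow> complex" where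
  "pairing c v = (\<Sum>j\<in>UNIV. c $ j * v $ j)"

definition lin_form :: "complex ^ ('i::finite) \<Rightarrow> 'i cpoly" where
  "lin_form c = (\<Sum>j\<in>UNIV. Poly_Mapping.single (Poly_Mapping.single j 1) (c $ j))"

definition substitute :: "('i \<Rightarrow> ('i::finite) cpoly) \<Rightarrow> 'i cpoly \<Rightarrow> 'i cpoly" where
  "substitute h f = (\<Sum>m\<in>keys f. Poly_Mapping.single 0 (lookup f m) * (\<Prod>j\<in>UNIV. h j ^ lookup m j))"

lemma monom_value_single [simp]: "monom_value (Poly_Mapping.single j k) v = v $ j ^ k"
proof -
  have "monom_value (Poly_Mapping.single j k) v = (\<Prod>i\<in>UNIV. if i = j then v $ j ^ k else 1)"
    unfolding monom_value_def by (intro prod.cong) (auto simp: lookup_single when_def)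
  then show ?thesis by simp
qed

lemma eval_lin_form [simp]: "eval_poly (lin_form c) v = pairing c v"
  by (simp add: lin_form_def pairing_def)

lemma eval_substitute [simp]: "eval_poly (substitute h f) v = eval_poly f (\<chi> j. eval_poly (h j) v)"
  by (simp add: substitute_def eval_poly_monom_value[of f] monom_value_def)

lemma pairing_add: "pairing (c + d) v = pairing c v + pairing d v"
  by (simp add: pairing_def ring_distribs sum.distrib)

lemma pairing_0: "pairing 0 v = 0"
  by (simp add: pairing_def)

lemma pairing_sum: "pairing (sum g K) v = (\<Sum>m\<in>K. pairing (g m) v)"
  by (induction K rule: infinite_finite_induct) (auto simp: pairing_0 pairing_add)

lemma pairing_scale: "pairing (k *s c) v = k * pairing c v"
  by (simp add: pairing_def sum_distrib_left mult_ac)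

lemma pairing_axis [simp]: "pairing (axis i 1) v = v $ i"
  by (simp add: pairing_def axis_def if_distrib if_distribR cong: if_cong)

lemma pairing_commute: "pairing c v = pairing v c"
  by (simp add: pairing_def mult.commute)

lemma pairing_scale_right: "pairing c (k *s v) = k * pairing c v"
  by (metis pairing_commute pairing_scale)

lemma lin_form_add: "lin_form (c + d) = lin_form c + lin_form d"
  by (rule cpoly_eqI) (simp add: pairing_add)

lemma lin_form_scale: "lin_form (k *s c) = Poly_Mapping.single 0 k * lin_form c"
  by (rule cpoly_eqI) (simp add: pairing_scale)

lemma lin_form_0: "lin_form 0 = 0"
  by (rule cpoly_eqI) (simp add: pairing_def)

lemma pairing_span_eq_0:
  assumes "c \<in> vec.span B" "\<And>b. b \<in> B \<Longrightarrow> pairing b v = 0"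
  shows "pairing c v = 0"
proof -
  have "vec.subspace {c. pairing c v = 0}"
    by (auto simp: vec.subspace_def pairing_0 pairing_add pairing_scale)
  then have "vec.span B \<subseteq> {c. pairing c v = 0}"
    using assms(2) by (intro vec.span_minimal) auto
  then show ?thesis using assms(1) by blast
qed

text \<open>
  The form of duality used throughout, since the pairing is symmetric: read with \<open>B\<close> as a set of linear forms, it gives
  a common zero of \<open>B\<close> at which \<open>c\<close> does not vanish; read with \<open>B\<close> as a set of vectors, it gives a
  linear form.
\<close>

lemma exists_functional_separating:
  fixes B :: "(complex ^ ('i::finite)) set"
  assumes "c \<notin> vec.span B"
  obtains v where "\<And>b. b \<in> B \<Longrightarrow> pairing b v = 0" "pairing c v = 1"
proof -
  obtain B' where B': "B' \<subseteq> B" "vec.independent B'" "B \<subseteq> vec.span B'"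
    using vec.maximal_independent_subset by blast
  have c: "c \<notin> vec.span B'"
    using assms B'(1) vec.span_mono by blast
  then have "vec.independent (insert c B')"
    using B' by (simp add: vec.independent_insertI)
  then obtain g :: "complex ^ 'i \<Rightarrow> complex ^ 'i"
    where g: "Vector_Spaces.linear (*s) (*s) g"
      and g1: "\<forall>x\<in>insert c B'. g x = (if x = c then 1 else 0)"
    using vec.linear_independent_extend[of "insert c B'" "\<lambda>x. if x = c then 1 else 0"] by blast
  fix k :: 'i
  define v :: "complex ^ 'i" where "v = (\<chi> j. g (axis j 1) $ k)"
  have gv: "pairing x v = g x $ k" for x
    unfolding linear_componentwise[OF g, of x k] by (simp add: pairing_def v_def)
  have "pairing b v = 0" if "b \<in> B" for b
  proof (rule pairing_span_eq_0)
    show "b \<in> vec.span B'" using that B'(3) by blast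
    fix b' assume "b' \<in> B'"
    moreover from this c have "b' \<noteq> c" using vec.span_base by blast
    ultimately show "pairing b' v = 0" using g1 by (simp add: gv)
  qed
  moreover have "pairing c v = 1" using g1 by (simp add: gv)
  ultimately show ?thesis by (rule that)
qed

text \<open>
  The independent forms in \<open>S\<close> become coordinates, and the \<open>i\<close>-th coordinate is kept, so that the chart
  \<open>x\<^sub>i = 1\<close> keeps its equation. The new coordinates are the pairings with \<open>r j\<close>, and \<open>N\<close> is the inverse
  change of coordinates.
\<close>

lemma extend_to_coordinates:
  fixes S :: "(complex ^ ('i::finite)) set"
  assumes "vec.independent S" "axis i 1 \<notin> vec.span S"
  obtains r :: "'i \<Rightarrow> complex ^ 'i" and N :: "complex ^ 'i ^ 'i"
  where "r i = axis i 1" "S \<subseteq> r ` (UNIV - {i})"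
    "\<And>w j. pairing (r j) (N *v w) = w $ j" "\<And>x. N *v (\<chi> j. pairing (r j) x) = x"
proof -
  have "vec.independent (insert (axis i 1) S)"
    using assms by (simp add: vec.independent_insertI)
  then obtain B where B: "insert (axis i 1) S \<subseteq> B" "vec.independent B" "UNIV \<subseteq> vec.span B"
    using vec.maximal_independent_subset_extend[of "insert (axis i 1) S" UNIV] by auto
  have fB: "finite B" using B(2) vec.finiteI_independent by blast
  have "card B = vec.dim (UNIV :: (complex ^ 'i) set)"
    using vec.basis_card_eq_dim[of B UNIV] B by auto
  then have cB: "card B = CARD('i)" by (simp add: card_cart_basis)
  have iB: "axis i 1 \<in> B" using B by blast
  have "card (UNIV - {i}) = card (B - {axis i 1})"
    using cB fB iB by simp
  then obtain r0 where r0: "bij_betw r0 (UNIV - {i}) (B - {axis i 1})"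
    using finite_same_card_bij[of "UNIV - {i}" "B - {axis i 1}"] fB by auto
  define r where "r j = (if j = i then axis i 1 else r0 j)" for j
  have r_img: "r ` (UNIV - {i}) = B - {axis i 1}"
    using r0 by (auto simp: r_def bij_betw_def)
  have r_range: "range r = B"
  proof -
    have "range r = insert (r i) (r ` (UNIV - {i}))" by auto
    then show ?thesis using iB by (auto simp: r_img) (auto simp: r_def)
  qed
  then have r_inj: "inj r"
    using cB by (intro eq_card_imp_inj_on) auto
  define M :: "complex ^ 'i ^ 'i" where "M = (\<chi> j. r j)"
  have row: "row j M = r j" for j
    by (simp add: row_def M_def vec_eq_iff)
  have Mv: "(M *v x) $ j = pairing (r j) x" for x j
    by (simp add: M_def matrix_vector_mult_def pairing_def)
  have "c j = 0" if "(\<Sum>j\<in>UNIV. c j *s row j M) = 0" for c :: "'i \<Rightarrow> complex" and j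
  proof -
    have "(\<Sum>b\<in>B. c (inv r b) *s b) = (\<Sum>j\<in>UNIV. c j *s r j)"
      unfolding r_range[symmetric] using r_inj by (subst sum.reindex) auto
    also have "\<dots> = 0" using that by (simp add: row)
    finally have "c (inv r (r j)) = 0"
      using vec.independentD[OF B(2) fB order.refl, of "\<lambda>b. c (inv r b)" "r j"] r_range by blast
    then show ?thesis using r_inj by simp
  qed
  then obtain N where MN: "M ** N = mat 1"
    using matrix_right_invertible_independent_rows[of M] by blast
  then have NM: "N ** M = mat 1" using matrix_left_right_inverse by blast
  show ?thesis
  proof (rule that)
    show "r i = axis i 1" by (simp add: r_def)
    have "axis i 1 \<notin> S" using assms(2) vec.span_base by blast
    then show "S \<subseteq> r ` (UNIV - {i})" using B(1) r_img by auto
    show "pairing (r j) (N *v w) = w $ j" for w j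
      by (metis Mv MN matrix_vector_mul_assoc matrix_vector_mul_lid)
    have "(\<chi> j. pairing (r j) x) = M *v x" for x
      by (simp add: vec_eq_iff Mv)
    then show "N *v (\<chi> j. pairing (r j) x) = x" for x
      by (simp add: matrix_vector_mul_assoc NM)
  qed
qed

section \<open>Ideals\<close>

lemma module_mult: "module ((*) :: 'a::comm_ring_1 \<Rightarrow> 'a \<Rightarrow> 'a)"
  by unfold_locales (auto simp: algebra_simps)

lemma ideal_of_base: "a \<in> G \<Longrightarrow> a \<in> ideal_of G"
  unfolding ideal_of_def by (rule module.span_base[OF module_mult])

lemma ideal_of_add: "a \<in> ideal_of G \<Longrightarrow> b \<in> ideal_of G \<Longrightarrow> a + b \<in> ideal_of G"
  unfolding ideal_of_def by (rule module.span_add[OF module_mult])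

lemma ideal_of_mult: "a \<in> ideal_of G \<Longrightarrow> b * a \<in> ideal_of G"
  unfolding ideal_of_def by (rule module.span_scale[OF module_mult])

lemma ideal_of_0: "0 \<in> ideal_of G"
  unfolding ideal_of_def by (rule module.span_zero[OF module_mult])

lemma ideal_of_diff: "a \<in> ideal_of G \<Longrightarrow> b \<in> ideal_of G \<Longrightarrow> a - b \<in> ideal_of G"
  unfolding ideal_of_def by (rule module.span_diff[OF module_mult])

lemma ideal_of_sum: "(\<And>x. x \<in> A \<Longrightarrow> f x \<in> ideal_of G) \<Longrightarrow> sum f A \<in> ideal_of G"
  unfolding ideal_of_def by (rule module.span_sum[OF module_mult])

lemma ideal_of_dvd: "a \<in> ideal_of G \<Longrightarrow> a dvd b \<Longrightarrow> b \<in> ideal_of G"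
  by (metis dvdE ideal_of_mult mult.commute)

lemma ideal_of_mono: "G \<subseteq> H \<Longrightarrow> ideal_of G \<subseteq> ideal_of H"
  unfolding ideal_of_def by (rule module.span_mono[OF module_mult])

lemma ideal_of_insert_iff: "a \<in> ideal_of (insert b G) \<longleftrightarrow> (\<exists>k. a - k * b \<in> ideal_of G)"
  unfolding ideal_of_def by (rule module.span_breakdown_eq[OF module_mult])

lemma lin_form_span_in_ideal:
  assumes "c \<in> vec.span D" "lin_form ` D \<subseteq> ideal_of G"
  shows "lin_form c \<in> ideal_of G"
proof -
  have "vec.subspace {c. lin_form c \<in> ideal_of G}"
    by (auto simp: vec.subspace_def lin_form_0 lin_form_add lin_form_scale
        intro: ideal_of_0 ideal_of_add ideal_of_mult)
  then have "vec.span D \<subseteq> {c. lin_form c \<in> ideal_of G}"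
    using assms(2) by (intro vec.span_minimal) auto
  then show ?thesis using assms(1) by blast
qed

lemma ideal_of_eval_eq_0:
  assumes "f \<in> ideal_of G" "\<And>g. g \<in> G \<Longrightarrow> eval_poly g v = 0"
  shows "eval_poly f v = 0"
proof -
  have "module.subspace (*) {f. eval_poly f v = 0}"
    by (auto simp: module.subspace_def[OF module_mult])
  then have "module.span (*) G \<subseteq> {f. eval_poly f v = 0}"
    using assms(2) by (intro module.span_minimal[OF module_mult]) auto
  then show ?thesis using assms(1) by (auto simp: ideal_of_def)
qed

section \<open>Products of linear forms in general position\<close>

text \<open>
  The local step. The forms vanishing at \<open>v\<close> are independent, and \<open>x\<^sub>i\<close> is independent of them because
  it does not vanish at \<open>v\<close>; so all of them are coordinates after a linear change. Let \<open>q\<close> be \<open>f\<close>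
  written in these coordinates, with \<open>x\<^sub>i\<close> set to 1. Up to the factors that do not vanish at \<open>v\<close>, the
  generators are squarefree monomials. If none of these divided a monomial \<open>m\<close> of \<open>q\<close>, then each would
  contain one of the coordinates missing in \<open>m\<close>, and \<open>f\<close> would vanish where these coordinates are
  zero. But restricting \<open>q\<close> there keeps the term \<open>m\<close>, a contradiction.
\<close>

lemma vanishing_locally_in_ideal:
  fixes E :: "(complex ^ ('i::finite)) set"
  assumes E: "finite E" "\<C> \<subseteq> Pow E"
    and v: "v $ i = 1"
    and ind: "vec.independent {c \<in> E. pairing c v = 0}"
    and f: "f \<in> chart_ring i"
    and van: "\<And>x. x $ i = 1 \<Longrightarrow> (\<And>C. C \<in> \<C> \<Longrightarrow> \<exists>c\<in>C. pairing c x = 0) \<Longrightarrow> eval_poly f x = 0"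
  shows "dehomogenize i (\<Prod>c\<in>{c \<in> E. pairing c v \<noteq> 0}. lin_form c) * f
      \<in> dehomogenize i ` ideal_of ((\<lambda>C. \<Prod>c\<in>C. lin_form c) ` \<C>)"
proof -
  define S where "S = {c \<in> E. pairing c v = 0}"
  define a where "a = (\<Prod>c\<in>{c \<in> E. pairing c v \<noteq> 0}. lin_form c)"
  have "axis i 1 \<notin> vec.span S"
  proof
    assume "axis i 1 \<in> vec.span S"
    then have "pairing (axis i 1) v = 0"
      by (rule pairing_span_eq_0) (simp add: S_def)
    then show False using v by simp
  qed
  then obtain r :: "'i \<Rightarrow> complex ^ 'i" and N :: "complex ^ 'i ^ 'i"
    where ri: "r i = axis i 1" and rS: "S \<subseteq> r ` (UNIV - {i})"
    and rN: "\<And>w j. pairing (r j) (N *v w) = w $ j"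
    and Nr: "\<And>x. N *v (\<chi> j. pairing (r j) x) = x"
    using extend_to_coordinates[OF ind[folded S_def]] by blast
  have "\<forall>c\<in>S. \<exists>j. j \<noteq> i \<and> r j = c" using rS by blast
  then obtain j where j: "\<And>c. c \<in> S \<Longrightarrow> j c \<noteq> i \<and> r (j c) = c" by metis
  define q where "q = dehomogenize i (substitute (\<lambda>k. lin_form (N $ k)) f)"
  have Nw: "(\<chi> k. pairing (N $ k) w) = N *v w" for w
    by (simp add: vec_eq_iff pairing_def matrix_vector_mult_def)
  have q: "eval_poly q w = eval_poly f (N *v set_coord_one i w)" for w
    by (simp add: q_def Nw)
  have monom: "\<exists>C\<in>\<C>. \<forall>c\<in>C \<inter> S. lookup m (j c) \<noteq> 0" if m: "m \<in> keys q" for m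
  proof (rule ccontr)
    assume neg: "\<not> (\<exists>C\<in>\<C>. \<forall>c\<in>C \<inter> S. lookup m (j c) \<noteq> 0)"
    have hit: "\<exists>c\<in>C. c \<in> S \<and> lookup m (j c) = 0" if "C \<in> \<C>" for C
    proof -
      have "\<not> (\<forall>c\<in>C \<inter> S. lookup m (j c) \<noteq> 0)" using neg that by meson
      then show ?thesis by auto
    qed
    (* K consists of the monomials that survive the restriction to the subspace where T vanishes. *)
    define T where "T = {c \<in> S. lookup m (j c) = 0}"
    define K where "K = {m' \<in> keys q. \<forall>c\<in>T. lookup m' (j c) = 0}"
    have "(\<Sum>m'\<in>K. lookup q m' * monom_value m' w) = 0" for w
    proof -
      define w' :: "complex ^ 'i" where
        "w' = (\<chi> k. if k \<in> j ` T then 0 else w $ k)"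
      have T0: "set_coord_one i w' $ j c = 0" if "c \<in> T" for c
        using j that by (auto simp: w'_def T_def set_coord_one_def)
      have "eval_poly q w' = 0"
        unfolding q
      proof (rule van)
        show "(N *v set_coord_one i w') $ i = 1"
          using rN[of i "set_coord_one i w'"] by (simp add: ri)
        fix C assume "C \<in> \<C>"
        from hit[OF this] obtain c where c: "c \<in> C" "c \<in> T" by (auto simp: T_def)
        have "pairing c (N *v set_coord_one i w') = 0"
          using rN[of "j c" "set_coord_one i w'"] T0[OF c(2)] j[of c] c(2) by (simp add: T_def)
        with c show "\<exists>c\<in>C. pairing c (N *v set_coord_one i w') = 0" by blast
      qed
      also have "eval_poly q w' = (\<Sum>m'\<in>K. lookup q m' * monom_value m' w')"
      proof -
        have "monom_value m' w' = 0" if "m' \<in> keys q - K" for m'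
        proof -
          from that obtain c where "c \<in> T" "lookup m' (j c) \<noteq> 0" by (auto simp: K_def)
          then have "w' $ j c ^ lookup m' (j c) = 0" by (simp add: w'_def)
          then show ?thesis unfolding monom_value_def by (meson UNIV_I finite prod_zero)
        qed
        then show ?thesis unfolding eval_poly_monom_value
          by (intro sum.mono_neutral_right) (auto simp: K_def)
      qed
      also have "\<dots> = (\<Sum>m'\<in>K. lookup q m' * monom_value m' w)"
      proof (rule sum.cong[OF refl])
        fix m' assume "m' \<in> K"
        then have "monom_value m' w' = monom_value m' w"
          unfolding monom_value_def by (intro prod.cong) (auto simp: w'_def K_def)
        then show "lookup q m' * monom_value m' w' = lookup q m' * monom_value m' w" by simp
      qed
      finally show ?thesis by simp
    qed
    then have "lookup q m = 0"
      using m by (intro monom_value_independent[of K "lookup q"]) (auto simp: K_def T_def)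
    then show False using m by (simp add: in_keys_iff)
  qed
  define h where "h = a * substitute (\<lambda>k. lin_form (r k)) q"
  have "h \<in> ideal_of ((\<lambda>C. \<Prod>c\<in>C. lin_form c) ` \<C>)"
    unfolding h_def substitute_def sum_distrib_left
  proof (rule ideal_of_sum)
    fix m assume "m \<in> keys q"
    from monom[OF this] obtain C where C: "C \<in> \<C>" "\<And>c. c \<in> C \<Longrightarrow> c \<in> S \<Longrightarrow> lookup m (j c) \<noteq> 0"
      by blast
    have CE: "C \<subseteq> E" using C(1) E by auto
    then have fC: "finite C" using E(1) finite_subset by blast
    have "(\<Prod>c\<in>C \<inter> S. lin_form c) = (\<Prod>k\<in>j ` (C \<inter> S). lin_form (r k))"
    proof (subst prod.reindex)
      show "inj_on j (C \<inter> S)" by (metis IntD2 inj_onI j)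
      show "(\<Prod>c\<in>C \<inter> S. lin_form c) = prod ((\<lambda>k. lin_form (r k)) \<circ> j) (C \<inter> S)"
        using j by (intro prod.cong) auto
    qed
    also have "\<dots> dvd (\<Prod>k\<in>UNIV. lin_form (r k) ^ lookup m k)"
      by (rule prod_dvd_prod_subset2) (use C(2) in \<open>auto intro!: dvd_power\<close>)
    finally have d1: "(\<Prod>c\<in>C \<inter> S. lin_form c) dvd \<dots>" .
    have d2: "(\<Prod>c\<in>C - S. lin_form c) dvd a"
      unfolding a_def using E(1) CE by (intro prod_dvd_prod_subset) (auto simp: S_def)
    have "(\<Prod>c\<in>C. lin_form c) = (\<Prod>c\<in>C - S. lin_form c) * (\<Prod>c\<in>C \<inter> S. lin_form c)"
      using fC by (subst prod.union_disjoint[symmetric]) (auto intro!: prod.cong)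
    also have "\<dots> dvd a * (Poly_Mapping.single 0 (lookup q m) * (\<Prod>k\<in>UNIV. lin_form (r k) ^ lookup m k))"
      using d1 d2 by (intro mult_dvd_mono) auto
    finally show "a * (Poly_Mapping.single 0 (lookup q m) * (\<Prod>k\<in>UNIV. lin_form (r k) ^ lookup m k))
        \<in> ideal_of ((\<lambda>C. \<Prod>c\<in>C. lin_form c) ` \<C>)"
      by (rule ideal_of_dvd[rotated]) (use C(1) in \<open>auto intro: ideal_of_base\<close>)
  qed
  moreover have "dehomogenize i h = dehomogenize i a * f"
  proof (rule cpoly_eqI)
    fix x
    let ?x = "set_coord_one i x"
    have "set_coord_one i (\<chi> k. pairing (r k) ?x) = (\<chi> k. pairing (r k) ?x)"
      by (rule set_coord_one_id) (simp add: ri)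
    then have "eval_poly (substitute (\<lambda>k. lin_form (r k)) q) ?x = eval_poly f ?x"
      by (simp add: q Nr)
    also have "\<dots> = eval_poly f x"
      by (metis f dehomogenize_chart_ring eval_dehomogenize)
    finally show "eval_poly (dehomogenize i h) x = eval_poly (dehomogenize i a * f) x"
      by (simp add: h_def)
  qed
  ultimately show ?thesis unfolding a_def by (metis image_eqI)
qed

lemma prod_invertible_mod_ideal:
  assumes "finite A" "\<And>a. a \<in> A \<Longrightarrow> \<exists>k. 1 - k * l a \<in> ideal_of G"
  shows "\<exists>k. 1 - k * (\<Prod>a\<in>A. l a) \<in> ideal_of G"
  using assms
proof (induction A rule: finite_induct)
  case empty
  show ?case by (rule exI[of _ 1]) (simp add: ideal_of_0)
next
  case (insert a A)
  from insert.prems obtain k where k: "1 - k * l a \<in> ideal_of G" by blast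
  from insert obtain k' where k': "1 - k' * (\<Prod>a\<in>A. l a) \<in> ideal_of G" by blast
  have "(1 - k * l a) + k * l a * (1 - k' * (\<Prod>a\<in>A. l a)) \<in> ideal_of G"
    using k k' by (intro ideal_of_add ideal_of_mult)
  also have "(1 - k * l a) + k * l a * (1 - k' * (\<Prod>a\<in>A. l a))
      = 1 - (k * k') * (\<Prod>a\<in>insert a A. l a)"
    using insert.hyps by (simp add: algebra_simps)
  finally show ?case by blast
qed

text \<open>
  The Nullstellensatz for the products of forms not vanishing at the various points of the chart. The
  set \<open>D\<close> collects forms already known to lie in the ideal. As long as \<open>D\<close> has a common zero \<open>v\<close> on the
  chart, each form not vanishing at \<open>v\<close> is new; adjoining it gives the unit ideal by induction, hence it
  is invertible modulo the ideal. Then so is the product of these forms, which lies in the ideal. Once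
  \<open>D\<close> has no common zero on the chart, its span contains \<open>x\<^sub>i\<close>, which is congruent to 1.
\<close>

lemma one_in_ideal_of_cofactors:
  fixes E :: "(complex ^ ('i::finite)) set"
  assumes "finite E"
    and "\<And>v. v $ i = 1 \<Longrightarrow> (\<Prod>c\<in>{c \<in> E. pairing c v \<noteq> 0}. lin_form c) \<in> ideal_of G"
    and "lin_form (axis i 1) - 1 \<in> ideal_of G"
    and "D \<subseteq> E" "lin_form ` D \<subseteq> ideal_of G"
  shows "1 \<in> ideal_of G"
  using assms(2-)
proof (induction "card (E - D)" arbitrary: D G rule: less_induct)
  case less
  show ?case
  proof (cases "axis i 1 \<in> vec.span D")
    case True
    then have "lin_form (axis i 1) \<in> ideal_of G"
      using less.prems lin_form_span_in_ideal by blast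
    from ideal_of_diff[OF this less.prems(2)] show ?thesis by simp
  next
    case False
    then obtain v where v: "\<And>b. b \<in> D \<Longrightarrow> pairing b v = 0" "pairing (axis i 1) v = 1"
      using exists_functional_separating by metis
    define A where "A = {c \<in> E. pairing c v \<noteq> 0}"
    have "\<exists>k. 1 - k * lin_form c \<in> ideal_of G" if c: "c \<in> A" for c
    proof -
      have cE: "c \<in> E" "c \<notin> D" using c v by (auto simp: A_def)
      have sub: "ideal_of G \<subseteq> ideal_of (insert (lin_form c) G)"
        by (rule ideal_of_mono) blast
      have "1 \<in> ideal_of (insert (lin_form c) G)"
      proof (rule less.hyps[of "insert c D"])
        show "card (E - insert c D) < card (E - D)"
          using cE \<open>finite E\<close> by (intro psubset_card_mono) auto
        show "lin_form ` insert c D \<subseteq> ideal_of (insert (lin_form c) G)"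
          using less.prems(4) sub by (auto intro: ideal_of_base)
      qed (use less.prems sub cE in auto)
      then show ?thesis by (simp add: ideal_of_insert_iff)
    qed
    then obtain k where "1 - k * (\<Prod>c\<in>A. lin_form c) \<in> ideal_of G"
      using prod_invertible_mod_ideal[of A lin_form G] \<open>finite E\<close> by (auto simp: A_def)
    moreover have "k * (\<Prod>c\<in>A. lin_form c) \<in> ideal_of G"
      using less.prems(1)[of v] v(2) by (intro ideal_of_mult) (simp add: A_def)
    ultimately have "(1 - k * (\<Prod>c\<in>A. lin_form c)) + k * (\<Prod>c\<in>A. lin_form c) \<in> ideal_of G"
      by (rule ideal_of_add)
    then show ?thesis by simp
  qed
qed

lemma line_of_proj_point: "v \<noteq> 0 \<Longrightarrow> line_of (proj_point v) = vec.span {v}"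
  unfolding proj_point_def by (rule Abs_proj_inverse) blast

lemma proj_cases:
  obtains v where "v \<noteq> 0" "p = proj_point v"
proof -
  obtain v where "v \<noteq> 0" "line_of p = vec.span {v}" using line_of[of p] by blast
  then have "line_of p = line_of (proj_point v)" by (simp add: line_of_proj_point)
  then have "p = proj_point v" by (simp add: line_of_inject)
  then show ?thesis using that \<open>v \<noteq> 0\<close> by blast
qed

lemma mem_line_of_proj_point: "v \<noteq> 0 \<Longrightarrow> w \<in> line_of (proj_point v) \<longleftrightarrow> (\<exists>k. w = k *s v)"
  by (auto simp: line_of_proj_point vec.span_singleton)

text \<open>
  A function \<open>f\<close> vanishing on the zero locus is caught by its conductor \<open>J\<close>, the ideal of all \<open>g\<close> such
  that \<open>g f\<close> is a section of the ideal on the chart: it contains the products of forms not vanishing at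
  a point by the local step, and \<open>x\<^sub>i - 1\<close> trivially, hence it contains 1.
\<close>

theorem zero_scheme_products_of_linear_forms_reduced:
  fixes E :: "(complex ^ ('i::finite)) set"
  assumes E: "finite E" "\<C> \<subseteq> Pow E"
    and ind: "\<And>v. v \<noteq> 0 \<Longrightarrow> vec.independent {c \<in> E. pairing c v = 0}"
  defines "G \<equiv> (\<lambda>C. \<Prod>c\<in>C. lin_form c) ` \<C>"
  shows "zero_scheme G = reduced_scheme (zero_locus G)"
proof (intro ext set_eqI iffI)
  fix i f assume "f \<in> zero_scheme G i"
  then obtain h where h: "h \<in> ideal_of G" "f = dehomogenize i h" by (auto simp: zero_scheme_def)
  have "eval_poly f v = 0" if "p \<in> zero_locus G" "v \<in> line_of p" "v $ i = 1" for p v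
    using that h(1) by (simp add: h(2) set_coord_one_id) (rule ideal_of_eval_eq_0, auto simp: zero_locus_def)
  then show "f \<in> reduced_scheme (zero_locus G) i"
    by (auto simp: reduced_scheme_def h(2) dehomogenize_in_chart_ring)
next
  fix i f assume "f \<in> reduced_scheme (zero_locus G) i"
  then have f: "f \<in> chart_ring i"
    and f0: "\<And>p v. p \<in> zero_locus G \<Longrightarrow> v \<in> line_of p \<Longrightarrow> v $ i = 1 \<Longrightarrow> eval_poly f v = 0"
    by (auto simp: reduced_scheme_def)
  have van: "eval_poly f x = 0"
    if x: "x $ i = 1" "\<And>C. C \<in> \<C> \<Longrightarrow> \<exists>c\<in>C. pairing c x = 0" for x
  proof -
    have x0: "x \<noteq> 0" using x(1) by auto
    have "eval_poly g w = 0" if gw: "g \<in> G" "w \<in> line_of (proj_point x)" for g w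
    proof -
      from gw(1) obtain C where C: "C \<in> \<C>" "g = (\<Prod>c\<in>C. lin_form c)" by (auto simp: G_def)
      have "finite C" using C(1) E by (meson PowD finite_subset subsetD)
      moreover from x(2)[OF C(1)] obtain c where "c \<in> C" "pairing c x = 0" by blast
      moreover obtain k where "w = k *s x" using gw(2) x0 by (auto simp: mem_line_of_proj_point)
      ultimately show ?thesis
        unfolding C(2) by (auto simp: pairing_scale_right prod_zero_iff)
    qed
    then have "proj_point x \<in> zero_locus G" by (auto simp: zero_locus_def)
    then show ?thesis using f0 x0 x(1) by (metis mem_line_of_proj_point vec.scale_one)
  qed
  define J where "J = {g. dehomogenize i g * f \<in> dehomogenize i ` ideal_of G}"
  have dehomogenize_0: "dehomogenize i 0 = 0" by (rule cpoly_eqI) simp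
  then have zero_img: "0 \<in> dehomogenize i ` ideal_of G"
    using ideal_of_0[of G] image_eqI[of 0 "dehomogenize i" 0] by simp
  have J: "ideal_of J = J"
    unfolding ideal_of_def module.span_eq_iff[OF module_mult] module.subspace_def[OF module_mult]
  proof (intro conjI ballI allI)
    show "0 \<in> J" using zero_img by (simp add: J_def dehomogenize_0)
  next
    fix x y assume "x \<in> J" "y \<in> J"
    then obtain a b where "a \<in> ideal_of G" "b \<in> ideal_of G"
      "dehomogenize i x * f = dehomogenize i a" "dehomogenize i y * f = dehomogenize i b"
      by (auto simp: J_def)
    then have "dehomogenize i (x + y) * f = dehomogenize i (a + b)" "a + b \<in> ideal_of G"
      by (auto simp: dehomogenize_add ring_distribs intro: ideal_of_add)
    then show "x + y \<in> J" by (auto simp: J_def)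
  next
    fix c x assume "x \<in> J"
    then obtain a where "a \<in> ideal_of G" "dehomogenize i x * f = dehomogenize i a"
      by (auto simp: J_def)
    then have "dehomogenize i (c * x) * f = dehomogenize i (c * a)" "c * a \<in> ideal_of G"
      by (auto simp: dehomogenize_mult mult.assoc intro: ideal_of_mult)
    then show "c * x \<in> J" by (auto simp: J_def)
  qed
  have "1 \<in> ideal_of J"
  proof (rule one_in_ideal_of_cofactors[OF \<open>finite E\<close>, where i = i and D = "{}"])
    show "(\<Prod>c\<in>{c \<in> E. pairing c v \<noteq> 0}. lin_form c) \<in> ideal_of J" if v: "v $ i = 1" for v
    proof -
      have "v \<noteq> 0" using v by auto
      from vanishing_locally_in_ideal[OF E v ind[OF this] f van]
      show ?thesis unfolding J by (simp add: J_def G_def)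
    qed
    have "dehomogenize i (lin_form (axis i 1) - 1) = 0" by (rule cpoly_eqI) simp
    then show "lin_form (axis i 1) - 1 \<in> ideal_of J"
      unfolding J using zero_img by (simp add: J_def)
  qed auto
  then have "dehomogenize i 1 * f \<in> dehomogenize i ` ideal_of G" by (simp add: J) (simp add: J_def)
  moreover have "dehomogenize i 1 = 1" by (rule cpoly_eqI) simp
  ultimately show "f \<in> zero_scheme G i" by (simp add: zero_scheme_def)
qed

text \<open>
  Let \<open>S\<close> be the set of forms vanishing at \<open>v\<close>. Suppose that some \<open>s\<close> in \<open>S\<close> depends on an independent
  set \<open>T \<subseteq> S - {s}\<close>, and extend \<open>T\<close> to a basis \<open>B \<subseteq> E\<close> of the span of \<open>E\<close>. If \<open>B\<close> does not span everything, it has a common nonzero zero, at which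
  all of \<open>E\<close> vanishes. Otherwise drop from \<open>B\<close> an element outside \<open>T\<close>, which exists as \<open>S\<close> is small;
  the remaining forms have a common nonzero zero, at which \<open>s\<close> vanishes as well. Either way too many
  forms vanish at one point.
\<close>

lemma general_position_independent:
  fixes E :: "(complex ^ ('i::finite)) set"
  assumes E: "finite E" "CARD('i) \<le> card E"
    and simple: "\<And>v. v \<noteq> 0 \<Longrightarrow> card {c \<in> E. pairing c v = 0} < CARD('i)"
    and v: "v \<noteq> 0"
  shows "vec.independent {c \<in> E. pairing c v = 0}"
proof (rule ccontr)
  define S where "S = {c \<in> E. pairing c v = 0}"
  assume "\<not> vec.independent {c \<in> E. pairing c v = 0}"
  then have dep: "vec.dependent S" by (simp add: S_def)
  have fS: "finite S" and cS: "card S < CARD('i)" using E simple[OF v] by (auto simp: S_def)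
  obtain T where T: "T \<subseteq> S" "vec.independent T" "S \<subseteq> vec.span T"
    using vec.maximal_independent_subset by blast
  with dep obtain s where s: "s \<in> S" "s \<notin> T" by (metis subsetI subset_antisym)
  have TE: "T \<subseteq> E" using T by (auto simp: S_def)
  obtain B where B: "T \<subseteq> B" "B \<subseteq> E" "vec.independent B" "E \<subseteq> vec.span B"
    using vec.maximal_independent_subset_extend[OF TE T(2)] by blast
  have fB: "finite B" using B(2) E finite_subset by blast
  have sB: "s \<notin> B"
  proof
    assume "s \<in> B"
    then have "s \<notin> vec.span (B - {s})" using B(3) vec.dependent_def by blast
    moreover have "vec.span T \<subseteq> vec.span (B - {s})" using B(1) s by (intro vec.span_mono) auto
    ultimately show False using T(3) s by blast
  qed
  show False
  proof (cases "vec.span B = UNIV")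
    case False
    then obtain c where "c \<notin> vec.span B" by blast
    then obtain w where w: "\<And>b. b \<in> B \<Longrightarrow> pairing b w = 0" "pairing c w = 1"
      using exists_functional_separating by metis
    then have "w \<noteq> 0" by (auto simp: pairing_def)
    moreover have "{c \<in> E. pairing c w = 0} = E"
      using B(4) w(1) pairing_span_eq_0 by blast
    ultimately show False using simple[of w] E(2) by simp
  next
    case True
    have "card B = vec.dim (UNIV :: (complex ^ 'i) set)"
      using vec.basis_card_eq_dim[of B UNIV] B True by auto
    then have cB: "card B = CARD('i)" by (simp add: card_cart_basis)
    have "card T \<le> card S" using T(1) fS card_mono by blast
    then have "T \<noteq> B" using cB cS by auto
    then obtain b where b: "b \<in> B" "b \<notin> T" using B(1) by blast
    have "b \<notin> vec.span (B - {b})" using B(3) b vec.dependent_def by blast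
    then obtain w where w: "\<And>c. c \<in> B - {b} \<Longrightarrow> pairing c w = 0" "pairing b w = 1"
      using exists_functional_separating by metis
    then have "w \<noteq> 0" by (auto simp: pairing_def)
    have "pairing s w = 0"
    proof (rule pairing_span_eq_0)
      show "s \<in> vec.span T" using T s by blast
      show "pairing t w = 0" if "t \<in> T" for t using w(1)[of t] that B(1) b by blast
    qed
    then have "insert s (B - {b}) \<subseteq> {c \<in> E. pairing c w = 0}"
      using w(1) B(2) s by (auto simp: S_def)
    then have "card (insert s (B - {b})) \<le> card {c \<in> E. pairing c w = 0}"
      using E(1) by (intro card_mono) auto
    moreover have "card (insert s (B - {b})) = CARD('i)"
      using fB sB b cB by (simp add: card_Suc_Diff1)
    ultimately show False using simple[OF \<open>w \<noteq> 0\<close>] by simp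
  qed
qed

section \<open>Linear subspaces as Zariski closures\<close>

lemma span_lines:
  assumes "\<And>v. v \<in> X \<Longrightarrow> v \<noteq> 0"
  shows "vec.span (\<Union>q\<in>proj_point ` X. line_of q) = vec.span X"
proof (rule vec.span_eq[THEN iffD2], intro conjI)
  show "(\<Union>q\<in>proj_point ` X. line_of q) \<subseteq> vec.span X"
    using assms by (auto simp: mem_line_of_proj_point intro!: vec.span_scale intro: vec.span_base)
  show "X \<subseteq> vec.span (\<Union>q\<in>proj_point ` X. line_of q)"
  proof
    fix v assume v: "v \<in> X"
    then have "v \<in> line_of (proj_point v)"
      using assms by (metis mem_line_of_proj_point vec.scale_one)
    then show "v \<in> vec.span (\<Union>q\<in>proj_point ` X. line_of q)"
      using v by (intro vec.span_base) blast
  qed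
qed

lemma line_subset_span_iff:
  assumes "v \<noteq> 0"
  shows "line_of (proj_point v) \<subseteq> vec.span X \<longleftrightarrow> v \<in> vec.span X"
  using assms by (auto simp: line_of_proj_point vec.span_base intro: vec.span_minimal[THEN subsetD, rotated -1])

lemma proj_point_in_proj_span_iff:
  assumes "\<And>v. v \<in> X \<Longrightarrow> v \<noteq> 0" "v \<noteq> 0"
  shows "proj_point v \<in> proj_span (proj_point ` X) \<longleftrightarrow> v \<in> vec.span X"
proof -
  have "vec.span (\<Union>q\<in>proj_point ` X. line_of q) = vec.span X"
    by (rule span_lines) (rule assms(1))
  then show ?thesis
    unfolding proj_span_def mem_Collect_eq by (simp only: line_subset_span_iff[OF assms(2)])
qed

lemma span_lines_proj_span:
  "vec.span (\<Union>q\<in>proj_span Y. line_of q) = vec.span (\<Union>q\<in>Y. line_of q)"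
proof (rule vec.span_eq[THEN iffD2], intro conjI)
  show "(\<Union>q\<in>proj_span Y. line_of q) \<subseteq> vec.span (\<Union>q\<in>Y. line_of q)"
    by (auto simp: proj_span_def)
  have "q \<in> proj_span Y" if "q \<in> Y" for q
    using that vec.span_base[of _ "\<Union>q\<in>Y. line_of q"] by (auto simp: proj_span_def)
  then show "(\<Union>q\<in>Y. line_of q) \<subseteq> vec.span (\<Union>q\<in>proj_span Y. line_of q)"
    by (auto intro!: vec.span_base)
qed

lemma proj_span_idem: "proj_span (proj_span Y) = proj_span Y"
  by (simp add: proj_span_def[of "proj_span Y"] span_lines_proj_span) (simp add: proj_span_def)

lemma subset_proj_span: "Y \<subseteq> proj_span Y"
  using vec.span_base[of _ "\<Union>q\<in>Y. line_of q"] by (auto simp: proj_span_def)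

lemma span_dim_proj_span:
  assumes "\<And>v. v \<in> X \<Longrightarrow> v \<noteq> 0"
  shows "span_dim (proj_span (proj_point ` X)) = int (vec.dim X) - 1"
  unfolding span_dim_def
  by (metis assms span_lines span_lines_proj_span vec.dim_span)

lemma proj_span_point: "proj_span {p} = {p}"
proof -
  obtain v where v: "v \<noteq> 0" "p = proj_point v" by (rule proj_cases)
  have "q = p" if "line_of q \<subseteq> line_of p" for q
  proof -
    obtain w where w: "w \<noteq> 0" "q = proj_point w" by (rule proj_cases)
    have "w \<in> line_of p" using that w by (metis mem_line_of_proj_point subsetD vec.scale_one)
    then obtain k where k: "w = k *s v" using v by (auto simp: mem_line_of_proj_point)
    then have "k \<noteq> 0" using w by auto
    have "line_of p \<subseteq> line_of q"
    proof
      fix u assume "u \<in> line_of p"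
      then obtain m where "u = m *s v" using v by (auto simp: mem_line_of_proj_point)
      then have "u = (m / k) *s w" using k \<open>k \<noteq> 0\<close> by (simp add: vec.scale_scale)
      then show "u \<in> line_of q" using w by (auto simp: mem_line_of_proj_point)
    qed
    with that show ?thesis by (simp add: line_of_inject[symmetric])
  qed
  moreover have "vec.span (line_of p) = line_of p"
    by (simp only: v(2) line_of_proj_point[OF v(1)] vec.span_span)
  then have "vec.span (\<Union>q\<in>{p}. line_of q) = line_of p" by (simp only: UN_simps SUP_insert SUP_empty sup_bot_right)
  ultimately show ?thesis unfolding proj_span_def by blast
qed

lemma homogeneous_lin_form: "homogeneous 1 (lin_form c)"
proof -
  have "\<exists>j. m = Poly_Mapping.single j 1" if "m \<in> keys (lin_form c)" for m
    using that keys_sum_subset[of "\<lambda>j. Poly_Mapping.single (Poly_Mapping.single j (1::nat)) (c $ j)" UNIV]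
    by (auto simp: lin_form_def split: if_splits)
  moreover have "(\<Sum>i\<in>UNIV. lookup (Poly_Mapping.single j (1::nat)) i) = 1" for j :: 'a
    by (simp add: lookup_single when_def)
  ultimately show ?thesis unfolding homogeneous_def by metis
qed

lemma zariski_closed_proj_span: "zariski_closed (proj_span Y)"
proof -
  define S where "S = (\<Union>q\<in>Y. line_of q)"
  define G where "G = lin_form ` {c. \<forall>s\<in>S. pairing c s = 0}"
  have "proj_span Y = zero_locus G"
  proof (intro set_eqI iffI)
    fix p assume p: "p \<in> proj_span Y"
    have "pairing c v = 0" if "v \<in> line_of p" "\<forall>s\<in>S. pairing c s = 0" for c v
      using pairing_span_eq_0[of v S c] that p by (auto simp: proj_span_def S_def pairing_commute)
    then show "p \<in> zero_locus G" by (auto simp: zero_locus_def G_def)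
  next
    fix p assume p: "p \<in> zero_locus G"
    have "v \<in> vec.span S" if v: "v \<in> line_of p" for v
    proof (rule ccontr)
      assume "v \<notin> vec.span S"
      then obtain c where c: "\<And>s. s \<in> S \<Longrightarrow> pairing s c = 0" "pairing v c = 1"
        using exists_functional_separating by metis
      then have "lin_form c \<in> G" by (auto simp: G_def pairing_commute)
      then have "eval_poly (lin_form c) v = 0" using p v by (auto simp: zero_locus_def)
      then show False using c(2) by (simp add: pairing_commute)
    qed
    then show "p \<in> proj_span Y" by (auto simp: proj_span_def S_def)
  qed
  moreover have "\<forall>f\<in>G. \<exists>d. homogeneous d f" using homogeneous_lin_form by (auto simp: G_def)
  ultimately show ?thesis by (auto simp: zariski_closed_def)
qed

text \<open>
  Needed for identity arguments: a polynomial vanishing at infinitely many points of a line vanishes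
  on the line.
\<close>

lemma eval_poly_on_line:
  "\<exists>q :: complex poly. \<forall>z. poly q z = eval_poly f (z *s a + u)"
proof -
  define q where "q = (\<Sum>m\<in>keys f. [:lookup f m:] * (\<Prod>i\<in>UNIV. [:u $ i, a $ i:] ^ lookup m i))"
  have "poly q z = eval_poly f (z *s a + u)" for z
    by (simp add: q_def eval_poly_def poly_sum poly_prod add.commute)
  then show ?thesis by blast
qed

text \<open>
  The complex span is reached by adding one multiple \<open>c x\<close> at a time. For real \<open>c \<ge> 0\<close> this stays in
  the cone up to the vector added before; as a polynomial in \<open>c\<close>, the value of \<open>f\<close> is then zero for all
  complex \<open>c\<close>. For the induction to work, vanishing is required on a translate of the whole cone.
\<close>

lemma vanishes_on_span_of_cone:
  assumes "0 \<in> C" and cone: "\<And>x y r. x \<in> C \<Longrightarrow> y \<in> C \<Longrightarrow> r \<ge> 0 \<Longrightarrow> complex_of_real r *s x + y \<in> C"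
    and van: "\<And>x. x \<in> C \<Longrightarrow> eval_poly f x = 0"
    and v: "v \<in> vec.span C"
  shows "eval_poly f v = 0"
proof -
  have "\<forall>w\<in>C. eval_poly f (v + w) = 0"
    using v
  proof (induction rule: vec.span_induct_alt)
    case base
    then show ?case using van by simp
  next
    case (step c x y)
    show ?case
    proof
      fix w assume w: "w \<in> C"
      obtain q where q: "\<And>z. poly q z = eval_poly f (z *s x + (y + w))"
        using eval_poly_on_line by metis
      have "poly q (complex_of_real r) = 0" if "r \<ge> 0" for r
      proof -
        have "complex_of_real r *s x + (y + w) = y + (complex_of_real r *s x + w)"
          by (rule add.left_commute)
        then show ?thesis using step(2) cone[OF step(1) w that] by (simp only: q)
      qed
      then have "complex_of_real ` {0..} \<subseteq> {z. poly q z = 0}" by auto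
      moreover have "infinite (complex_of_real ` {0..})"
        using infinite_Ici by (subst finite_image_iff) (auto simp: inj_on_def)
      ultimately have "infinite {z. poly q z = 0}" using finite_subset by blast
      then have "q = 0" using poly_roots_finite by blast
      then have "eval_poly f (c *s x + (y + w)) = 0" using q[of c] by simp
      then show "eval_poly f (c *s x + y + w) = 0" by (simp add: add.assoc)
    qed
  qed
  then show ?thesis using assms(1) by force
qed

text \<open>
  This is where faces of real polytopes turn into complex linear spaces: linear spaces are closed, and
  conversely the equations of any closed set containing \<open>X\<close> vanish on the real cone over \<open>X\<close> and
  therefore on its complex span.
\<close>

lemma zariski_closure_convex_cone:
  assumes nz: "\<And>x. x \<in> X \<Longrightarrow> x \<noteq> 0" and "X \<noteq> {}"
    and conv: "\<And>x y r s. x \<in> X \<Longrightarrow> y \<in> X \<Longrightarrow> r \<ge> 0 \<Longrightarrow> s \<ge> 0 \<Longrightarrow>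
       \<exists>t\<ge>0. \<exists>z\<in>X. complex_of_real r *s x + complex_of_real s *s y = complex_of_real t *s z"
  shows "zariski_closure (proj_point ` X) = proj_span (proj_point ` X)"
  unfolding zariski_closure_def
proof (rule hull_unique)
  show "proj_point ` X \<subseteq> proj_span (proj_point ` X)" by (rule subset_proj_span)
  show "zariski_closed (proj_span (proj_point ` X))" by (rule zariski_closed_proj_span)
  fix Z assume XZ: "proj_point ` X \<subseteq> Z" and "zariski_closed Z"
  then obtain G where Z: "Z = zero_locus G" by (auto simp: zariski_closed_def)
  define C where "C = {complex_of_real t *s x | t x. t \<ge> 0 \<and> x \<in> X}"
  have XC: "X \<subseteq> C" by (force simp: C_def intro: exI[of _ 1])
  have C0: "0 \<in> C" using \<open>X \<noteq> {}\<close> by (force simp: C_def intro: exI[of _ 0])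
  have cone: "complex_of_real r *s x + y \<in> C" if "x \<in> C" "y \<in> C" "r \<ge> 0" for x y r
  proof -
    from that obtain t x' s y' where *: "x = complex_of_real t *s x'" "y = complex_of_real s *s y'"
      "t \<ge> 0" "s \<ge> 0" "x' \<in> X" "y' \<in> X" by (auto simp: C_def)
    with conv[of x' y' "r * t" s] that(3) obtain t' z where "t' \<ge> 0" "z \<in> X"
      "complex_of_real (r * t) *s x' + complex_of_real s *s y' = complex_of_real t' *s z" by auto
    then show ?thesis using * by (auto simp: C_def vec.scale_scale)
  qed
  show "proj_span (proj_point ` X) \<subseteq> Z"
  proof
    fix p assume p: "p \<in> proj_span (proj_point ` X)"
    have "eval_poly f v = 0" if "f \<in> G" "v \<in> line_of p" for f v
    proof (rule vanishes_on_span_of_cone[OF C0 cone])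
      show "eval_poly f x = 0" if "x \<in> C" for x
      proof -
        from that obtain t x' where x': "x = complex_of_real t *s x'" "x' \<in> X" by (auto simp: C_def)
        then have "x \<in> line_of (proj_point x')" using nz by (auto simp: mem_line_of_proj_point)
        moreover have "proj_point x' \<in> zero_locus G" using XZ x'(2) Z by blast
        ultimately show ?thesis using \<open>f \<in> G\<close> by (auto simp: zero_locus_def)
      qed
      have "v \<in> vec.span X" using p that(2) span_lines[OF nz] by (auto simp: proj_span_def)
      then show "v \<in> vec.span C" using vec.span_mono[OF XC] by blast
    qed auto
    then show "p \<in> Z" by (auto simp: Z zero_locus_def)
  qed
qed

section \<open>Facets of polytopes\<close>

text \<open>
  If there were at most as many facets as the dimension, some nonzero direction \<open>d\<close> would violate no
  facet inequality: take \<open>d\<close> orthogonal to all facet normals but one and adjust its sign. The ray from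
  an interior point in direction \<open>d\<close> must leave the bounded polytope through some facet, but the
  corresponding linear function does not increase along the ray.
\<close>

lemma polytope_facet_lower_bound:
  fixes Q :: "'a::euclidean_space set"
  assumes Q: "polytope Q" "aff_dim Q = int DIM('a)"
  shows "DIM('a) < card {F. F facet_of Q}"
proof (rule ccontr)
  define \<F> where "\<F> = {F. F facet_of Q}"
  assume "\<not> DIM('a) < card {F. F facet_of Q}"
  then have card: "card \<F> \<le> DIM('a)" by (simp add: \<F>_def)
  have fin: "finite \<F>" using Q(1) by (simp add: \<F>_def finite_polytope_facets)
  have poly: "polyhedron Q" using Q(1) by (rule polytope_imp_polyhedron)
  have "\<forall>F\<in>\<F>. \<exists>a b. a \<noteq> 0 \<and> Q \<subseteq> {x. a \<bullet> x \<le> b} \<and> F = Q \<inter> {x. a \<bullet> x = b}"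
    unfolding \<F>_def using facet_of_polyhedron[OF poly] by (metis mem_Collect_eq)
  then obtain a b where ab: "\<And>F. F \<in> \<F> \<Longrightarrow> Q \<subseteq> {x. a F \<bullet> x \<le> b F} \<and> F = Q \<inter> {x. a F \<bullet> x = b F}"
    by metis
  obtain d where d: "d \<noteq> 0" "\<And>F. F \<in> \<F> \<Longrightarrow> a F \<bullet> d \<le> 0"
  proof (cases "\<F> = {}")
    case True
    then show ?thesis using that[of "SOME i. i \<in> Basis"] nonzero_Basis some_in_eq nonempty_Basis by blast
  next
    case False
    then obtain F0 where F0: "F0 \<in> \<F>" by blast
    have "dim (a ` (\<F> - {F0})) \<le> card (a ` (\<F> - {F0}))"
      using fin by (intro dim_le_card') auto
    also have "\<dots> \<le> card (\<F> - {F0})" using fin by (intro card_image_le) auto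
    also have "\<dots> < card \<F>" using fin F0 by (rule card_Diff1_less)
    finally have "dim (a ` (\<F> - {F0})) < DIM('a)" using card by simp
    then obtain d0 where d0: "d0 \<noteq> 0" "\<And>y. y \<in> span (a ` (\<F> - {F0})) \<Longrightarrow> orthogonal d0 y"
      using orthogonal_to_subspace_exists by metis
    have z: "a F \<bullet> d0 = 0" if "F \<in> \<F>" "F \<noteq> F0" for F
      using d0(2)[of "a F"] that by (simp add: span_base orthogonal_def inner_commute)
    define d where "d = (if a F0 \<bullet> d0 \<le> 0 then d0 else - d0)"
    have "a F \<bullet> d \<le> 0" if "F \<in> \<F>" for F
      using z[OF that] by (cases "F = F0") (auto simp: d_def)
    then show ?thesis using that[of d] d0(1) by (auto simp: d_def)
  qed
  have hull: "affine hull Q = UNIV" using Q(2) by (simp add: aff_dim_eq_full)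
  have conv: "convex Q" using Q(1) by (rule polytope_imp_convex)
  have "Q \<noteq> {}" using Q(2) by (auto simp: aff_dim_empty)
  then have "interior Q \<noteq> {}"
    using rel_interior_eq_empty[OF conv] rel_interior_interior[OF hull] by simp
  then obtain x where x: "x \<in> interior Q" by blast
  have bdd: "bounded Q" using Q(1) polytope_imp_bounded by blast
  obtain t where t: "0 < t" "x + t *\<^sub>R d \<in> frontier Q"
    using ray_to_frontier[OF bdd x d(1)] by metis
  have fr: "frontier Q = \<Union>\<F>"
    using rel_frontier_of_polyhedron[OF poly] rel_frontier_frontier[OF hull] by (simp add: \<F>_def)
  from t(2) obtain F where F: "F \<in> \<F>" "x + t *\<^sub>R d \<in> F" unfolding fr by blast
  have "x \<notin> F" using x fr F(1) by (auto simp: frontier_def)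
  moreover have "x \<in> Q" using x interior_subset by blast
  ultimately have "a F \<bullet> x < b F" using ab[OF F(1)] by force
  moreover have "a F \<bullet> (x + t *\<^sub>R d) = b F" using ab[OF F(1)] F(2) by blast
  then have "a F \<bullet> x + t * (a F \<bullet> d) = b F" by (simp add: inner_add_right)
  moreover have "t * (a F \<bullet> d) \<le> 0" using t(1) d(2)[OF F(1)] by (simp add: mult_nonneg_nonpos)
  ultimately show False by linarith
qed

section \<open>Polytopes in projective space\<close>

definition affine_point :: "real ^ ('n::finite) \<Rightarrow> complex ^ 'n option" where
  "affine_point x = (\<chi> i. case i of None \<Rightarrow> 1 | Some j \<Rightarrow> complex_of_real (x $ j))"

lemma affine_point_None [simp]: "affine_point x $ None = 1"
  and affine_point_Some [simp]: "affine_point x $ Some j = complex_of_real (x $ j)"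
  by (simp_all add: affine_point_def)

lemma affine_point_inject: "affine_point x = affine_point y \<longleftrightarrow> x = y"
proof
  assume *: "affine_point x = affine_point y"
  show "x = y"
  proof (simp only: vec_eq_iff, intro allI)
    fix j
    have "affine_point x $ Some j = affine_point y $ Some j" by (simp only: *)
    then show "x $ j = y $ j" by simp
  qed
qed simp

lemma vec_option_eqI:
  fixes v w :: "'a ^ ('n::finite) option"
  assumes "v $ None = w $ None" "\<And>j. v $ Some j = w $ Some j"
  shows "v = w"
proof (simp only: vec_eq_iff, intro allI)
  show "v $ i = w $ i" for i using assms by (cases i) auto
qed

lemma sum_UNIV_option:
  fixes f :: "('n::finite) option \<Rightarrow> 'a::comm_monoid_add"
  shows "(\<Sum>i\<in>UNIV. f i) = f None + (\<Sum>j\<in>UNIV. f (Some j))"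
  by (simp add: UNIV_option_conv sum.reindex)

text \<open>
  \<open>A\<close> is the projective change of coordinates of an affine chart; \<open>A'\<close> brings points back to the
  standard chart \<open>x \<mapsto> (1 : x)\<close>.
\<close>

locale projective_chart =
  fixes A A' :: "complex ^ ('n::finite) option ^ 'n option"
  assumes inv: "A' ** A = mat 1"
begin

definition lift :: "real ^ 'n \<Rightarrow> complex ^ 'n option" where
  "lift x = A *v affine_point x"

lemma A'_lift: "A' *v lift x = affine_point x"
  by (simp add: lift_def matrix_vector_mul_assoc inv)

lemma lift_nonzero: "lift x \<noteq> 0"
proof
  assume "lift x = 0"
  then have "affine_point x = 0" using A'_lift[of x] by simp
  then have "affine_point x $ None = 0" by simp
  then show False by simp
qed

lemma lift_inject: "lift x = lift y \<longleftrightarrow> x = y"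
  by (metis A'_lift affine_point_inject)

lemma lift_cone:
  assumes "convex F" "x \<in> F" "y \<in> F" "r \<ge> 0" "s \<ge> 0"
  shows "\<exists>t\<ge>0. \<exists>z\<in>F. complex_of_real r *s lift x + complex_of_real s *s lift y = complex_of_real t *s lift z"
proof (cases "r + s = 0")
  case True
  then have "r = 0" "s = 0" using assms by auto
  then show ?thesis using assms(2) by (intro exI[of _ 0]) auto
next
  case False
  then have pos: "r + s > 0" using assms by linarith
  define z where "z = (r / (r + s)) *\<^sub>R x + (s / (r + s)) *\<^sub>R y"
  have "z \<in> F" unfolding z_def using assms pos
    by (intro convexD) (auto simp: add_divide_distrib[symmetric])
  moreover have z: "(r + s) *\<^sub>R z = r *\<^sub>R x + s *\<^sub>R y"
    using pos by (simp add: z_def scaleR_add_right)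
  have zj: "(r + s) * z $ j = r * x $ j + s * y $ j" for j
    using arg_cong[OF z, of "\<lambda>v. v $ j"] by simp
  have "complex_of_real r *s affine_point x + complex_of_real s *s affine_point y
      = complex_of_real (r + s) *s affine_point z"
  proof (rule vec_option_eqI)
    show "(complex_of_real r *s affine_point x + complex_of_real s *s affine_point y) $ Some j
        = (complex_of_real (r + s) *s affine_point z) $ Some j" for j
      using arg_cong[OF zj[of j], of complex_of_real] by (simp add: algebra_simps)
  qed simp
  from arg_cong[OF this, of "\<lambda>v. A *v v"]
  have "complex_of_real r *s lift x + complex_of_real s *s lift y = complex_of_real (r + s) *s lift z"
    by (simp only: lift_def matrix_vector_right_distrib vec.scale)
  ultimately show ?thesis using pos by (intro exI[of _ "r + s"]) auto
qed

lemma zariski_closure_lift: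
  assumes "convex F" "F \<noteq> {}"
  shows "zariski_closure (proj_point ` lift ` F) = proj_span (proj_point ` lift ` F)"
proof (rule zariski_closure_convex_cone)
  fix v w r s assume "v \<in> lift ` F" "w \<in> lift ` F" "(r::real) \<ge> 0" "(s::real) \<ge> 0"
  then show "\<exists>t\<ge>0. \<exists>z\<in>lift ` F. complex_of_real r *s v + complex_of_real s *s w = complex_of_real t *s z"
    using lift_cone[OF assms(1)] by blast
next
  show "v \<noteq> 0" if "v \<in> lift ` F" for v using that by (auto simp: lift_nonzero)
qed (use assms(2) in simp)

text \<open>
  A complex dependency between real points splits into its real and imaginary parts, and the
  homogenizing coordinate turns each of them into an affine dependency.
\<close>

lemma independent_lift:
  assumes "finite B" "\<not> affine_dependent B"
  shows "vec.independent (lift ` B)"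
proof (rule vec.independent_if_scalars_zero)
  show "finite (lift ` B)" using assms by simp
  fix f v assume f: "(\<Sum>v\<in>lift ` B. f v *s v) = 0" and v: "v \<in> lift ` B"
  have "(\<Sum>x\<in>B. f (lift x) *s lift x) = 0"
    using f by (subst (asm) sum.reindex) (auto simp: inj_on_def lift_inject)
  then have "A' *v (\<Sum>x\<in>B. f (lift x) *s lift x) = 0" by simp
  then have s0: "(\<Sum>x\<in>B. f (lift x) *s affine_point x) = 0"
    by (simp only: vec.sum vec.scale A'_lift)
  have sN: "(\<Sum>x\<in>B. f (lift x)) = 0"
    using arg_cong[OF s0, of "\<lambda>v. v $ None"] by (simp add: sum_component)
  have sS: "(\<Sum>x\<in>B. f (lift x) * complex_of_real (x $ j)) = 0" for j
    using arg_cong[OF s0, of "\<lambda>v. v $ Some j"] by (simp add: sum_component)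
  have *: "\<forall>x\<in>B. g x = 0" if "sum g B = 0" "\<And>j. (\<Sum>x\<in>B. g x * x $ j) = 0" for g
  proof -
    have "(\<Sum>x\<in>B. g x *\<^sub>R x) = 0" using that(2) by (simp add: vec_eq_iff sum_component)
    then show ?thesis using that(1) assms affine_dependent_explicit_finite[OF assms(1)] by blast
  qed
  have re: "\<forall>x\<in>B. Re (f (lift x)) = 0"
  proof (rule *)
    show "(\<Sum>x\<in>B. Re (f (lift x))) = 0" using arg_cong[OF sN, of Re] by simp
    show "(\<Sum>x\<in>B. Re (f (lift x)) * x $ j) = 0" for j using arg_cong[OF sS[of j], of Re] by simp
  qed
  have im: "\<forall>x\<in>B. Im (f (lift x)) = 0"
  proof (rule *)
    show "(\<Sum>x\<in>B. Im (f (lift x))) = 0" using arg_cong[OF sN, of Im] by simp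
    show "(\<Sum>x\<in>B. Im (f (lift x)) * x $ j) = 0" for j using arg_cong[OF sS[of j], of Im] by simp
  qed
  show "f v = 0" using v re im by (auto simp: complex_eq_iff)
qed

text \<open>
  A real affine equation extends to a complex linear form, so no further real point of the polytope
  enters the complex span of a face. This makes distinct facets span distinct hyperplanes.
\<close>

lemma lift_in_span_hyperplane:
  assumes "\<And>x. x \<in> F \<Longrightarrow> a \<bullet> x = b" "lift y \<in> vec.span (lift ` F)"
  shows "a \<bullet> y = b"
proof -
  define c :: "complex ^ 'n option" where
    "c = (\<chi> i. case i of None \<Rightarrow> - complex_of_real b | Some j \<Rightarrow> complex_of_real (a $ j))"
  have c: "pairing c (affine_point x) = complex_of_real (a \<bullet> x - b)" for x
    by (simp add: pairing_def c_def sum_UNIV_option inner_vec_def)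
  have "vec.subspace {w. pairing c (A' *v w) = 0}"
    by (auto simp: vec.subspace_def vec.add vec.scale pairing_scale_right)
       (simp_all add: pairing_def ring_distribs sum.distrib)
  moreover have "lift ` F \<subseteq> {w. pairing c (A' *v w) = 0}"
    using assms(1) by (auto simp: A'_lift c)
  ultimately have "vec.span (lift ` F) \<subseteq> {w. pairing c (A' *v w) = 0}"
    by (intro vec.span_minimal)
  then have "pairing c (affine_point y) = 0" using assms(2) by (auto simp: A'_lift)
  then show ?thesis by (simp add: c)
qed

lemma dim_lift_facet:
  assumes Q: "polyhedron Q" "aff_dim Q = int CARD('n)" and F: "F facet_of Q"
  shows "vec.dim (lift ` F) = CARD('n)"
proof (rule antisym)
  obtain a b where ab: "a \<noteq> 0" "Q \<subseteq> {x. a \<bullet> x \<le> b}" "F = Q \<inter> {x. a \<bullet> x = b}"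
    using facet_of_polyhedron[OF Q(1) F] by metis
  have "F \<noteq> Q" using F by auto
  then obtain y where y: "y \<in> Q" "y \<notin> F" using ab(3) by blast
  have "lift y \<notin> vec.span (lift ` F)"
    using lift_in_span_hyperplane[of F a b y] y ab(3) by blast
  then have "vec.span (lift ` F) \<subset> vec.span (UNIV :: (complex ^ 'n option) set)" by auto
  then have "vec.dim (lift ` F) < vec.dim (UNIV :: (complex ^ 'n option) set)"
    by (rule vec.dim_psubset)
  then show "vec.dim (lift ` F) \<le> CARD('n)" by (simp add: card_cart_basis)
next
  obtain B where B: "B \<subseteq> F" "\<not> affine_dependent B" "int (card B) = aff_dim F + 1"
    using aff_dim_inner_basis_exists[of F] by metis
  have "int (card B) = int CARD('n)" using B(3) F Q(2) by (simp add: facet_of_def)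
  then have cB: "card B = CARD('n)" by simp
  have "finite B" using B(2) aff_independent_finite by blast
  have "CARD('n) = card (lift ` B)"
    using cB by (simp add: card_image inj_on_def lift_inject)
  also have "\<dots> \<le> vec.dim (lift ` F)"
    using B(1) independent_lift[OF \<open>finite B\<close> B(2)]
    by (intro vec.independent_card_le_dim) auto
  finally show "CARD('n) \<le> vec.dim (lift ` F)" .
qed

end

text \<open>
  All that the theorem uses about polytopes: the members of \<open>P\<close> are linear spaces, each of them
  contains a vertex because a compact convex face has an extreme point, and there are enough facets.
  For the last claim facets of the real polytope are mapped injectively to facets of \<open>P\<close>.
\<close>

lemma proj_polytope_properties:
  fixes P :: "('n::finite) option proj set set"
  assumes "proj_polytope P"
  shows proj_polytope_finite: "finite P"
    and proj_polytope_linear: "\<And>F. F \<in> P \<Longrightarrow> proj_span F = F"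
    and proj_polytope_vertex: "\<And>F. F \<in> P \<Longrightarrow> \<exists>u\<in>vertices P. u \<in> F"
    and proj_polytope_card_facets: "CARD('n) < card (facets P)"
proof -
  obtain Q :: "(real ^ 'n) set" and \<phi> where Q: "polytope Q" "aff_dim Q = int CARD('n)"
    and \<phi>: "affine_chart \<phi>" and P: "P = {zariski_closure (\<phi> ` F) |F. F face_of Q \<and> F \<noteq> {}}"
    using assms by (auto simp: proj_polytope_def)
  obtain A :: "complex ^ 'n option ^ 'n option" where A: "invertible A" and
    \<phi>A: "\<phi> = (\<lambda>x. proj_point (A *v affine_point x))"
    using \<phi> by (auto simp: affine_chart_def affine_point_def)
  obtain A' where A': "A' ** A = mat 1" using A by (auto simp: invertible_def)
  interpret projective_chart A A' by unfold_locales (rule A')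
  have \<phi>F: "\<phi> ` F = proj_point ` lift ` F" for F by (auto simp: \<phi>A lift_def)
  have closure: "zariski_closure (\<phi> ` F) = proj_span (proj_point ` lift ` F)"
    if "F face_of Q" "F \<noteq> {}" for F
    using that zariski_closure_lift[of F] face_of_imp_convex[OF that(1)] by (simp add: \<phi>F)
  have "finite {F. F face_of Q}" using Q(1) by (rule finite_polytope_faces)
  then have "finite ((\<lambda>F. zariski_closure (\<phi> ` F)) ` {F. F face_of Q})" by simp
  then show fin: "finite P" by (rule rev_finite_subset) (auto simp: P)
  have P_cases: "\<exists>F0. F0 face_of Q \<and> F0 \<noteq> {} \<and> F = proj_span (proj_point ` lift ` F0)"
    if "F \<in> P" for F
    using that closure unfolding P by blast
  show "proj_span F = F" if "F \<in> P" for F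
    using P_cases[OF that] proj_span_idem by metis
  show "\<exists>u\<in>vertices P. u \<in> F" if "F \<in> P" for F
  proof -
    obtain F0 where F0: "F0 face_of Q" "F0 \<noteq> {}" "F = proj_span (proj_point ` lift ` F0)"
      using P_cases[OF \<open>F \<in> P\<close>] by metis
    have "compact F0" "convex F0"
      using F0 Q(1) face_of_polytope_polytope polytope_imp_compact polytope_imp_convex by blast+
    then obtain x where "x extreme_point_of F0" using extreme_point_exists_convex F0(2) by blast
    then have "{x} face_of F0" by (simp add: face_of_singleton)
    then have x: "{x} face_of Q" "x \<in> F0" using F0(1) face_of_trans face_of_imp_subset by blast+
    have "zariski_closure (\<phi> ` {x}) = {proj_point (lift x)}"
      using closure[OF x(1)] by (simp add: proj_span_point)
    then have "proj_point (lift x) \<in> vertices P" using x(1) by (force simp: vertices_def P)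
    moreover have "proj_point (lift x) \<in> F"
      unfolding F0(3) using x(2) by (intro subsetD[OF subset_proj_span] imageI)
    ultimately show ?thesis by blast
  qed
  define \<F> where "\<F> = {F. F facet_of Q}"
  define h where "h F = proj_span (proj_point ` lift ` F)" for F
  have poly: "polyhedron Q" using Q(1) by (rule polytope_imp_polyhedron)
  have "h F \<in> facets P" if "F \<in> \<F>" for F
  proof -
    have F: "F facet_of Q" using that by (simp add: \<F>_def)
    then have "F face_of Q" "F \<noteq> {}" by (auto simp: facet_of_def)
    then have "h F \<in> P" using closure by (force simp: P h_def)
    moreover have "span_dim (h F) = int CARD('n) - 1"
      unfolding h_def using dim_lift_facet[OF poly Q(2) F] lift_nonzero
      by (subst span_dim_proj_span) auto
    ultimately show ?thesis by (simp add: facets_def)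
  qed
  then have sub: "h ` \<F> \<subseteq> facets P" by blast
  have le: "F \<subseteq> F'" if "F \<in> \<F>" "F' \<in> \<F>" "h F = h F'" for F F'
  proof
    fix y assume y: "y \<in> F"
    have "F' facet_of Q" "F facet_of Q" using that by (auto simp: \<F>_def)
    then obtain a b where ab: "F' = Q \<inter> {x. a \<bullet> x = b}" using facet_of_polyhedron[OF poly] by metis
    have "y \<in> Q" using y \<open>F facet_of Q\<close> facet_of_imp_subset by blast
    have "proj_point (lift y) \<in> h F'"
      unfolding that(3)[symmetric] unfolding h_def using y by (intro subsetD[OF subset_proj_span] imageI)
    then have "lift y \<in> vec.span (lift ` F')"
      unfolding h_def using lift_nonzero by (subst (asm) proj_point_in_proj_span_iff) auto
    then have "a \<bullet> y = b" using lift_in_span_hyperplane[of F' a b y] ab by blast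
    then show "y \<in> F'" using \<open>y \<in> Q\<close> ab by blast
  qed
  then have "inj_on h \<F>" by (auto simp: inj_on_def)
  then have "card \<F> = card (h ` \<F>)" by (simp add: card_image)
  also have "\<dots> \<le> card (facets P)"
    using sub fin by (intro card_mono) (auto simp: facets_def)
  finally show "CARD('n) < card (facets P)"
    using polytope_facet_lower_bound[OF Q(1)] Q(2) by (simp add: \<F>_def)
qed

section \<open>The Wachspress map\<close>

lemma homogeneous_1_lin_form:
  assumes "homogeneous 1 f"
  obtains c where "f = lin_form c"
proof -
  have "\<exists>j. m = Poly_Mapping.single j 1" if "m \<in> keys f" for m
  proof -
    have "(\<Sum>i\<in>UNIV. lookup m i) = 1" using assms that by (auto simp: homogeneous_def)
    then obtain j where j: "lookup m j = 1" "\<And>k. k \<noteq> j \<Longrightarrow> lookup m k = 0"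
      by (metis UNIV_I finite sum_eq_1_iff)
    then have "m = Poly_Mapping.single j 1"
      by (intro poly_mapping_eqI) (auto simp: lookup_single when_def)
    then show ?thesis by blast
  qed
  then obtain j where j: "\<And>m. m \<in> keys f \<Longrightarrow> m = Poly_Mapping.single (j m) 1" by metis
  define c where "c = (\<Sum>m\<in>keys f. lookup f m *s axis (j m) 1)"
  have "eval_poly f v = pairing c v" for v
  proof -
    have "eval_poly f v = (\<Sum>m\<in>keys f. lookup f m * v $ j m)"
      unfolding eval_poly_monom_value using j by (intro sum.cong refl) (metis power_one_right monom_value_single)
    also have "\<dots> = pairing c v"
      by (simp add: c_def pairing_sum pairing_scale)
    finally show ?thesis .
  qed
  then have "f = lin_form c" by (intro cpoly_eqI) simp
  then show ?thesis by (rule that)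
qed

text \<open>
  Among the intersections of hyperplanes through \<open>p\<close>, the intersection of all of them is the smallest,
  so it decides whether \<open>p\<close> is residual. It contains a face iff it contains a vertex, and a vertex
  \<open>u\<close> in it means that the coordinate of the Wachspress map at \<open>u\<close> is a product of forms not vanishing
  at \<open>p\<close>.
\<close>

lemma residual_arrangement_eq_zero_locus:
  fixes P :: "('n::finite) option proj set set"
  assumes P: "finite P" "\<And>F. F \<in> P \<Longrightarrow> proj_span F = F" "\<And>F. F \<in> P \<Longrightarrow> \<exists>u\<in>vertices P. u \<in> F"
    and l: "\<And>F. F \<in> facets P \<Longrightarrow> zero_locus {l F} = F"
    and lin: "\<And>F. F \<in> facets P \<Longrightarrow> \<exists>c. l F = lin_form c"
  shows "residual_arrangement P = zero_locus (wachspress P l ` vertices P)"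
proof (intro set_eqI)
  fix p :: "'n option proj"
  obtain v where v: "v \<noteq> 0" "p = proj_point v" by (rule proj_cases)
  have fin: "finite (facets P)" using P(1) by (simp add: facets_def)
  have FP: "F \<in> P" if "F \<in> facets P" for F using that by (simp add: facets_def)
  have arr: "arrangement P = facets P" using P(2) FP by (force simp: arrangement_def)
  have lv: "p \<in> F \<longleftrightarrow> eval_poly (l F) v = 0" if F: "F \<in> facets P" for F
  proof -
    obtain c where c: "l F = lin_form c" using lin[OF F] by blast
    have "p \<in> F \<longleftrightarrow> p \<in> zero_locus {l F}" using l[OF F] by simp
    also have "\<dots> \<longleftrightarrow> (\<forall>k. pairing c (k *s v) = 0)"
      using v by (auto simp: zero_locus_def mem_line_of_proj_point c)
    also have "\<dots> \<longleftrightarrow> pairing c v = 0"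
      by (auto simp: pairing_scale_right)
    finally show ?thesis by (simp add: c)
  qed
  have zl: "p \<in> zero_locus (wachspress P l ` vertices P) \<longleftrightarrow>
      (\<forall>u\<in>vertices P. \<exists>F\<in>facets P. u \<notin> F \<and> p \<in> F)"
  proof -
    have scale: "eval_poly (l F) (k *s v) = k * eval_poly (l F) v" if "F \<in> facets P" for F k
      using lin[OF that] by (auto simp: pairing_scale_right)
    have van: "eval_poly (wachspress P l u) w = 0 \<longleftrightarrow> (\<exists>F\<in>facets P. u \<notin> F \<and> eval_poly (l F) w = 0)"
      for u w using fin by (auto simp: wachspress_def prod_zero_iff)
    have "p \<in> zero_locus (wachspress P l ` vertices P) \<longleftrightarrow>
        (\<forall>u\<in>vertices P. \<forall>k. eval_poly (wachspress P l u) (k *s v) = 0)"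
      using v by (auto simp: zero_locus_def mem_line_of_proj_point)
    also have "\<dots> \<longleftrightarrow> (\<forall>u\<in>vertices P. eval_poly (wachspress P l u) v = 0)"
    proof (rule ball_cong[OF refl])
      fix u
      show "(\<forall>k. eval_poly (wachspress P l u) (k *s v) = 0) \<longleftrightarrow> eval_poly (wachspress P l u) v = 0"
      proof
        assume "\<forall>k. eval_poly (wachspress P l u) (k *s v) = 0"
        from spec[OF this, of 1] show "eval_poly (wachspress P l u) v = 0" by simp
      qed (auto simp: van scale)
    qed
    also have "\<dots> \<longleftrightarrow> (\<forall>u\<in>vertices P. \<exists>F\<in>facets P. u \<notin> F \<and> p \<in> F)"
      by (simp add: van lv cong: bex_cong)
    finally show ?thesis .
  qed
  show "p \<in> residual_arrangement P \<longleftrightarrow> p \<in> zero_locus (wachspress P l ` vertices P)"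
    unfolding zl
  proof
    assume "p \<in> residual_arrangement P"
    then obtain \<A> where \<A>: "\<A> \<subseteq> facets P" "p \<in> \<Inter>\<A>" "\<forall>F\<in>P. \<not> F \<subseteq> \<Inter>\<A>"
      by (auto simp: residual_arrangement_def arr)
    show "\<forall>u\<in>vertices P. \<exists>F\<in>facets P. u \<notin> F \<and> p \<in> F"
    proof
      fix u assume "u \<in> vertices P"
      then have "{u} \<in> P" by (simp add: vertices_def)
      then have "\<not> {u} \<subseteq> \<Inter>\<A>" using \<A>(3) by (rule bspec[rotated])
      then obtain F where "F \<in> \<A>" "u \<notin> F" by auto
      then show "\<exists>F\<in>facets P. u \<notin> F \<and> p \<in> F" using \<A>(1,2) by blast
    qed
  next
    assume *: "\<forall>u\<in>vertices P. \<exists>F\<in>facets P. u \<notin> F \<and> p \<in> F"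
    define \<A> where "\<A> = {F \<in> facets P. p \<in> F}"
    have "\<not> F \<subseteq> \<Inter>\<A>" if F: "F \<in> P" for F
    proof
      assume "F \<subseteq> \<Inter>\<A>"
      moreover from P(3)[OF F] obtain u where u: "u \<in> vertices P" "u \<in> F" by blast
      moreover from * u(1) obtain F' where "F' \<in> \<A>" "u \<notin> F'" unfolding \<A>_def by blast
      ultimately show False by blast
    qed
    moreover have "\<A> \<subseteq> arrangement P" "p \<in> \<Inter>\<A>" by (auto simp: \<A>_def arr)
    ultimately have "\<Inter>\<A> \<in> {L. (\<exists>\<A> \<subseteq> arrangement P. L = \<Inter>\<A>) \<and> (\<forall>F\<in>P. \<not> F \<subseteq> L)}"
      by (intro CollectI conjI exI[of _ \<A>]) auto
    then show "p \<in> residual_arrangement P"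
      unfolding residual_arrangement_def using \<open>p \<in> \<Inter>\<A>\<close> by (rule UnionI)
  qed
qed

theorem theorem1p10:
  fixes P :: "('n::finite) option proj set set"
    and l :: "'n option proj set \<Rightarrow> 'n option cpoly"
  assumes "proj_polytope P"
    and "simple_arrangement P"
    and "\<And>F. F \<in> facets P \<Longrightarrow> defines_hyperplane (l F) (proj_span F)"
  shows "wachspress_base_locus P l = reduced_scheme (residual_arrangement P)"
proof -
  note P = proj_polytope_properties[OF assms(1)]
  have FP: "F \<in> P" if "F \<in> facets P" for F using that by (simp add: facets_def)
  have fin: "finite (facets P)" using P(1) by (simp add: facets_def)
  have arr: "arrangement P = facets P" using P(2) FP by (force simp: arrangement_def)
  have lF: "zero_locus {l F} = F" "\<exists>c. l F = lin_form c" if F: "F \<in> facets P" for F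
    using assms(3)[OF F] P(2)[OF FP[OF F]] homogeneous_1_lin_form[of "l F"]
    unfolding defines_hyperplane_def by metis+
  then obtain c where c: "\<And>F. F \<in> facets P \<Longrightarrow> l F = lin_form (c F)" by metis
  have inj: "inj_on c (facets P)" by (metis c inj_onI lF(1))
  (* Facets are replaced by the coefficient vectors of their forms; c is injective because a facet is
     recovered from its form as the zero locus. *)
  define E where "E = c ` facets P"
  define \<C> where "\<C> = (\<lambda>u. c ` {F \<in> facets P. u \<notin> F}) ` vertices P"
  have "wachspress P l u = (\<Prod>a\<in>c ` {F \<in> facets P. u \<notin> F}. lin_form a)" for u
    unfolding wachspress_def
    by (subst prod.reindex) (auto intro: inj_on_subset[OF inj] prod.cong simp: c)
  then have W: "wachspress P l ` vertices P = (\<lambda>C. \<Prod>a\<in>C. lin_form a) ` \<C>"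
    by (simp add: \<C>_def image_image)
  have E: "finite E" "\<C> \<subseteq> Pow E" using fin by (auto simp: E_def \<C>_def)
  have cardE: "CARD('n option) \<le> card E"
    using P(4) by (simp add: E_def card_image[OF inj])
  have "card {a \<in> E. pairing a v = 0} < CARD('n option)" if v: "v \<noteq> 0" for v
  proof -
    have "{a \<in> E. pairing a v = 0} \<subseteq> c ` {F \<in> facets P. proj_point v \<in> F}"
    proof
      fix a assume "a \<in> {a \<in> E. pairing a v = 0}"
      then obtain F where F: "F \<in> facets P" "a = c F" "pairing (c F) v = 0" by (auto simp: E_def)
      then have "proj_point v \<in> zero_locus {l F}"
        using v by (auto simp: zero_locus_def mem_line_of_proj_point c pairing_scale_right)
      then show "a \<in> c ` {F \<in> facets P. proj_point v \<in> F}" using F lF(1) by blast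
    qed
    then have "card {a \<in> E. pairing a v = 0} \<le> card (c ` {F \<in> facets P. proj_point v \<in> F})"
      using fin by (intro card_mono) auto
    also have "\<dots> \<le> card {F \<in> facets P. proj_point v \<in> F}"
      using fin by (intro card_image_le) auto
    also have "\<dots> \<le> CARD('n)" using assms(2) by (simp add: simple_arrangement_def arr)
    finally show ?thesis by simp
  qed
  then have "vec.independent {a \<in> E. pairing a v = 0}" if "v \<noteq> 0" for v
    using general_position_independent[OF E(1) cardE] that by blast
  then have "wachspress_base_locus P l = reduced_scheme (zero_locus (wachspress P l ` vertices P))"
    unfolding wachspress_base_locus_def W
    by (rule zero_scheme_products_of_linear_forms_reduced[OF E])
  also have "zero_locus (wachspress P l ` vertices P) = residual_arrangement P"
    by (rule residual_arrangement_eq_zero_locus[symmetric]) (fact P lF)+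
  finally show ?thesis .
qed

end
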